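(* Let $\mathfrak g$ be of type $A_{n-1}^{(1)}$, let $L$ be a multiplicity array, and let $\lambda=(\lambda_1,\ldots,\lambda_n)$ be an $n$-tuple of nonnegative integers with $\sum_{i=1}^n\lambda_i=\sum_{(a,i)\in\mathcal H}a\,i\,L_i^{(a)}$. Then $\mathrm{RC}(L,\lambda)=\widetilde{\mathrm{RC}}(L,\lambda)$; that is, the set of unrestricted rigged configurations of weight $\lambda$ (generated by the crystal operators) equals the set of extended rigged configurations (characterized by explicit lower bounds).
   Context: Setting: $\overline I=\{1,\ldots,n-1\}$ is the index set of the underlying finite type $A_{n-1}$, with simple roots $\alpha_a$, fundamental weights $\Lambda_a$, and Cartan matrix $A_{ab}=(\alpha_a|\alpha_b)$. Put $\mathcal H=\overline I\times\mathbb Z_{>0}$. A multiplicity array is $L=(L_i^{(a)}\mid(a,i)\in\mathcal H)$ with nonnegative integer entries, finitely many nonzero. The tuple $\lambda$ corresponds to the weight $\Lambda=\sum_{i\in\overline I}(\lambda_i-\lambda_{i+1})\Lambda_i$, and $\lambda$ and $\Lambda$ are used interchangeably. Configurations: $\mathrm C(L,\lambda)$ is the set of $(L,\lambda)$-configurations, i.e. sequences of partitions $\nu=(\nu^{(a)})_{a\in\overline I}$ with $\sum_{(a,i)\in\mathcal H} i\,m_i^{(a)}\alpha_a=\sum_{(a,i)\in\mathcal H} i\,L_i^{(a)}\Lambda_a-\Lambda$, where $m_i^{(a)}$ is the number of parts of length $i$ in $\nu^{(a)}$. Vacancy numbers: $p_i^{(a)}=\sum_{j\ge1}\min(i,j)L_j^{(a)}-\sum_{(b,j)\in\mathcal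 H}(\alpha_a|\alpha_b)\min(i,j)m_j^{(b)}$. A configuration is admissible if all $p_i^{(a)}\ge0$. Riggings: a rigging $J$ of $\nu$ assigns to each part of each $\nu^{(a)}$ an integer label, up to permuting labels among equal parts of the same $\nu^{(a)}$. So $(\nu,J)$ amounts to, for each $a$, a finite multiset $(\nu,J)^{(a)}$ of strings $(i,x)$ ($i$ = length, $x$ = label); equivalently $J=(J^{(a,i)}\mid(a,i)\in\mathcal H)$ where $J^{(a,i)}$ is the weakly decreasing sequence of the $m_i^{(a)}$ labels of the parts of length $i$ in $\nu^{(a)}$. The colabel of $(i,x)$ in $(\nu,J)^{(a)}$ is $p_i^{(a)}-x$. For dominant $\Lambda$, $\overline{\mathrm{RC}}(L,\Lambda)$ is the set of $(\nu,J)$ with $\nu$ an admissible $(L,\Lambda)$-configuration and $0\le x\le p_i^{(a)}$ for every string $(i,x)$ in $(\nu,J)^{(a)}$; $\overline{\mathrm{RC}}(L)$ is the union over all dominant $\Lambda$. Operators, for $a\in\overline I$: (1) $e_a(\nu,J)$: undefined if $(\nu,J)^{(a)}$ has no string with negative label. Otherwise select, among strings of $(\nu,J)^{(a)}$ with the smallest (negative) label, one of smallest length; remove a box from it, increase its label by one (a string of length $1$, whose label is then $-1$, is deleted), and change the labels of all other strings so that their colabels are unchanged. (2) $f_a(\nu,J)$: select, among strings of $(\nu,J)^{(a)}$ with the smallest nonpositive label, one of largest length; add a box to it, decrease its label by one, and change the labels of all other strings so that their colabels are unchanged. If there is no string with nonpositive label, instead add a new string of length $1$ with label $-1$ (keeping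 all other colabels fixed). If the result is not valid, i.e. some label exceeds the corresponding vacancy number, $f_a(\nu,J)$ is undefined. $\mathrm{RC}(L)$ is the set generated from $\overline{\mathrm{RC}}(L)$ by the operators $e_a,f_a$, $a\in\overline I$. The weight is $\mathrm{wt}(\nu,J)=\sum_{(a,i)\in\mathcal H}i(L_i^{(a)}\Lambda_a-m_i^{(a)}\alpha_a)$, and $\mathrm{RC}(L,\lambda)=\{(\nu,J)\in\mathrm{RC}(L)\mid\mathrm{wt}(\nu,J)=\Lambda\}$. Extended rigged configurations: let $c_k=\lambda_{k+1}+\lambda_{k+2}+\cdots+\lambda_n$ for $1\le k\le n-1$, $c_n=0$, and $c_0=c_1$. Let $\lambda'$ be the shape whose $k$-th column has length $c_k$, $1\le k\le n-1$. Let $\mathcal A(\lambda')$ be the set of tableaux $t$ of shape $\lambda'$ (fillings, with $t_{j,k}$ the entry in row $j$, column $k$) whose entries are strictly decreasing down columns and such that the letters in column $k$ are from $\{1,2,\ldots,c_{k-1}\}$. For $t\in\mathcal A(\lambda')$ the lower bound is $$M_i^{(a)}(t)=-\sum_{j=1}^{c_a}\chi(i\ge t_{j,a})+\sum_{j=1}^{c_{a+1}}\chi(i\ge t_{j,a+1}),$$ where $\chi(S)=1$ if $S$ is true and $0$ otherwise. For integers $M,p,m$ with $m\ge0$, an $(M,p,m)$-quasipartition is a tuple of integers $\mu=(\mu_1,\ldots,\mu_m)$ with $M\le\mu_m\le\mu_{m-1}\le\cdots\le\mu_1\le p$ (for $m=0$: the empty tuple, no condition). $\widetilde{\mathrm{RC}}(L,\lambda)$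 is the set of all $(\nu,J)$ with $\nu\in\mathrm C(L,\lambda)$ and $J=(J^{(a,i)}\mid(a,i)\in\mathcal H)$ for which there is some $t\in\mathcal A(\lambda')$ (the same for all $(a,i)$) such that every $J^{(a,i)}$ is an $(M_i^{(a)}(t),p_i^{(a)},m_i^{(a)})$-quasipartition. *)

theory Defs
  imports Complex_Main "HOL-Library.Multiset"
begin

text \<open>
  Sums over infinite index sets with finitely many nonzero summands are written with the
  library's \<open>sum'\<close>, which sums over the support (plain \<open>sum\<close> is 0 on every infinite set).
\<close>

section \<open>Root data of type A\<close>

definition index_set :: "nat \<Rightarrow> nat set" where
  "index_set n = {a. 1 \<le> a \<and> a < n}"

definition node_set :: "nat \<Rightarrow> (nat \<times> nat) set" where
  "node_set n = index_set n \<times> {i. 0 < i}"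

definition cartan :: "nat \<Rightarrow> nat \<Rightarrow> int" where
  "cartan a b = (if a = b then 2 else if a = b + 1 \<or> b = a + 1 then - 1 else 0)"

text \<open>
  A weight is represented by its coefficients with respect to the fundamental weights, extended by
  0 outside the index set. The coefficient of \<open>\<Lambda>\<^sub>b\<close> in \<open>\<alpha>\<^sub>a\<close> is \<open>(\<alpha>\<^sub>a|\<alpha>\<^sub>b)\<close>.
\<close>

type_synonym weight = "nat \<Rightarrow> int"

definition fund_weight :: "nat \<Rightarrow> weight" where
  "fund_weight a = (\<lambda>b. if b = a then 1 else 0)"

definition simple_root :: "nat \<Rightarrow> nat \<Rightarrow> weight" where
  "simple_root n a = (\<lambda>b. if b \<in> index_set n then cartan a b else 0)"

definition dominant :: "nat \<Rightarrow> weight \<Rightarrow> bool" where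
  "dominant n \<Lambda> \<longleftrightarrow> (\<forall>b. b \<notin> index_set n \<longrightarrow> \<Lambda> b = 0) \<and> (\<forall>b\<in>index_set n. 0 \<le> \<Lambda> b)"

text \<open>An \<open>n\<close>-tuple is a function of which only the values at \<open>1, \<dots>, n\<close> are used.\<close>

definition tuple_weight :: "nat \<Rightarrow> (nat \<Rightarrow> nat) \<Rightarrow> weight" where
  "tuple_weight n lam =
     (\<lambda>b. \<Sum>i\<in>index_set n. (int (lam i) - int (lam (i + 1))) * fund_weight i b)"

section \<open>Configurations and rigged configurations\<close>

text \<open>
  Only the values \<open>L a i\<close> with \<open>(a, i)\<close> in \<open>node_set n\<close> are used.
\<close>

definition multiplicity_array :: "nat \<Rightarrow> (nat \<Rightarrow> nat \<Rightarrow> nat) \<Rightarrow> bool" where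
  "multiplicity_array n L \<longleftrightarrow> finite {(a, i) \<in> node_set n. L a i \<noteq> 0}"

text \<open>A partition is the multiset of its (positive) parts, so \<open>m\<^sub>i\<^sup>(\<^sup>a\<^sup>)\<close> is \<open>count (\<nu> a) i\<close>.\<close>

type_synonym config = "nat \<Rightarrow> nat multiset"

definition configs :: "nat \<Rightarrow> (nat \<Rightarrow> nat \<Rightarrow> nat) \<Rightarrow> weight \<Rightarrow> config set" where
  "configs n L \<Lambda> = {\<nu>.
     (\<forall>a. \<forall>i\<in>#\<nu> a. 0 < i) \<and> (\<forall>a. a \<notin> index_set n \<longrightarrow> \<nu> a = {#}) \<and>
     (\<forall>b. sum' (\<lambda>(a, i). int i * int (count (\<nu> a) i) * simple_root n a b) (node_set n)
        = sum' (\<lambda>(a, i). int i * int (L a i) * fund_weight a b) (node_set n) - \<Lambda> b)}"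

definition vacancy :: "nat \<Rightarrow> (nat \<Rightarrow> nat \<Rightarrow> nat) \<Rightarrow> config \<Rightarrow> nat \<Rightarrow> nat \<Rightarrow> int" where
  "vacancy n L \<nu> a i =
     sum' (\<lambda>j. int (min i j) * int (L a j)) {j. 1 \<le> j}
     - sum' (\<lambda>(b, j). cartan a b * int (min i j) * int (count (\<nu> b) j)) (node_set n)"

definition admissible :: "nat \<Rightarrow> (nat \<Rightarrow> nat \<Rightarrow> nat) \<Rightarrow> config \<Rightarrow> bool" where
  "admissible n L \<nu> \<longleftrightarrow> (\<forall>(a, i)\<in>node_set n. 0 \<le> vacancy n L \<nu> a i)"

text \<open>
  A pair \<open>(\<nu>, J)\<close> is a family of multisets of strings (length, label); \<open>shape\<close> recovers \<open>\<nu>\<close>.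
\<close>

type_synonym rigged = "nat \<Rightarrow> (nat \<times> int) multiset"

definition shape :: "rigged \<Rightarrow> config" where
  "shape R = (\<lambda>a. image_mset fst (R a))"

text \<open>\<open>J\<^sup>(\<^sup>a\<^sup>,\<^sup>i\<^sup>)\<close>, the labels of the strings of length \<open>i\<close> in weakly decreasing order.\<close>

definition labels :: "rigged \<Rightarrow> nat \<Rightarrow> nat \<Rightarrow> int list" where
  "labels R a i =
     rev (sorted_list_of_multiset (image_mset snd (filter_mset (\<lambda>s. fst s = i) (R a))))"

definition RC_bar_at :: "nat \<Rightarrow> (nat \<Rightarrow> nat \<Rightarrow> nat) \<Rightarrow> weight \<Rightarrow> rigged set" where
  "RC_bar_at n L \<Lambda> = {R. shape R \<in> configs n L \<Lambda> \<and> admissible n L (shape R) \<and>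
     (\<forall>a\<in>index_set n. \<forall>(i, x)\<in>#R a. 0 \<le> x \<and> x \<le> vacancy n L (shape R) a i)}"

definition RC_bar :: "nat \<Rightarrow> (nat \<Rightarrow> nat \<Rightarrow> nat) \<Rightarrow> rigged set" where
  "RC_bar n L = (\<Union>\<Lambda>\<in>{\<Lambda>. dominant n \<Lambda>}. RC_bar_at n L \<Lambda>)"

section \<open>Crystal operators\<close>

text \<open>
  \<open>modify n L R a old new\<close> replaces the strings \<open>old\<close> of \<open>R a\<close> by \<open>new\<close> (each is empty or a
  single string); the labels of the remaining strings, in all \<open>R b\<close>, change by the same amount
  as the vacancy numbers, i.e. their colabels are unchanged.
\<close>

definition modify :: "nat \<Rightarrow> (nat \<Rightarrow> nat \<Rightarrow> nat) \<Rightarrow> rigged \<Rightarrow> nat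
    \<Rightarrow> (nat \<times> int) multiset \<Rightarrow> (nat \<times> int) multiset \<Rightarrow> rigged" where
  "modify n L R a old new =
     (let rest = R(a := R a - old);
          \<nu> = shape R;
          \<nu>' = shape (rest(a := rest a + new));
          kept = (\<lambda>b. image_mset
                   (\<lambda>(i, x). (i, x + (vacancy n L \<nu>' b i - vacancy n L \<nu> b i))) (rest b))
      in kept(a := kept a + new))"

definition e_op :: "nat \<Rightarrow> (nat \<Rightarrow> nat \<Rightarrow> nat) \<Rightarrow> nat \<Rightarrow> rigged \<Rightarrow> rigged option" where
  "e_op n L a R =
     (if \<exists>(i, x)\<in>#R a. x < 0 then
        let x = Min (snd ` set_mset (R a));
            i = Min {i. (i, x) \<in># R a}
        in Some (modify n L R a {#(i, x)#} (if i = 1 then {#} else {#(i - 1, x + 1)#}))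
      else None)"

definition f_op :: "nat \<Rightarrow> (nat \<Rightarrow> nat \<Rightarrow> nat) \<Rightarrow> nat \<Rightarrow> rigged \<Rightarrow> rigged option" where
  "f_op n L a R =
     (let R' =
        (if \<exists>(i, x)\<in>#R a. x \<le> 0 then
           let x = Min (snd ` set_mset (R a));
               i = Max {i. (i, x) \<in># R a}
           in modify n L R a {#(i, x)#} {#(i + 1, x - 1)#}
         else modify n L R a {#} {#(1, - 1)#})
      in if \<forall>b\<in>index_set n. \<forall>(i, x)\<in>#R' b. x \<le> vacancy n L (shape R') b i
         then Some R' else None)"

inductive_set RC :: "nat \<Rightarrow> (nat \<Rightarrow> nat \<Rightarrow> nat) \<Rightarrow> rigged set"
  for n :: nat and L :: "nat \<Rightarrow> nat \<Rightarrow> nat" where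
  base: "R \<in> RC_bar n L \<Longrightarrow> R \<in> RC n L"
| e_step: "R \<in> RC n L \<Longrightarrow> a \<in> index_set n \<Longrightarrow> e_op n L a R = Some R' \<Longrightarrow> R' \<in> RC n L"
| f_step: "R \<in> RC n L \<Longrightarrow> a \<in> index_set n \<Longrightarrow> f_op n L a R = Some R' \<Longrightarrow> R' \<in> RC n L"

definition wt :: "nat \<Rightarrow> (nat \<Rightarrow> nat \<Rightarrow> nat) \<Rightarrow> rigged \<Rightarrow> weight" where
  "wt n L R = (\<lambda>b. sum' (\<lambda>(a, i). int i *
     (int (L a i) * fund_weight a b - int (count (shape R a) i) * simple_root n a b)) (node_set n))"

definition unrestricted_RC ::
    "nat \<Rightarrow> (nat \<Rightarrow> nat \<Rightarrow> nat) \<Rightarrow> (nat \<Rightarrow> nat) \<Rightarrow> rigged set" where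
  "unrestricted_RC n L lam = {R \<in> RC n L. wt n L R = tuple_weight n lam}"

section \<open>Extended rigged configurations\<close>

definition col_len :: "nat \<Rightarrow> (nat \<Rightarrow> nat) \<Rightarrow> nat \<Rightarrow> nat" where
  "col_len n lam k = (if k = 0 then (\<Sum>j=2..n. lam j) else (\<Sum>j=k+1..n. lam j))"

text \<open>
  \<open>t j k\<close> is the entry in row \<open>j\<close> and column \<open>k\<close>; it is 0 outside the shape, so that
  tableaux and their representations correspond one to one.
\<close>

definition tableaux :: "nat \<Rightarrow> (nat \<Rightarrow> nat) \<Rightarrow> (nat \<Rightarrow> nat \<Rightarrow> nat) set" where
  "tableaux n lam = {t.
     (\<forall>k\<in>index_set n. \<forall>j\<in>{1..col_len n lam k}. t j k \<in> {1..col_len n lam (k - 1)}) \<and>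
     (\<forall>k\<in>index_set n. \<forall>j. 1 \<le> j \<and> j < col_len n lam k \<longrightarrow> t (j + 1) k < t j k) \<and>
     (\<forall>j k. \<not> (k \<in> index_set n \<and> j \<in> {1..col_len n lam k}) \<longrightarrow> t j k = 0)}"

definition lower_bound ::
    "nat \<Rightarrow> (nat \<Rightarrow> nat) \<Rightarrow> (nat \<Rightarrow> nat \<Rightarrow> nat) \<Rightarrow> nat \<Rightarrow> nat \<Rightarrow> int" where
  "lower_bound n lam t a i =
     - (\<Sum>j=1..col_len n lam a. if i \<ge> t j a then 1 else 0)
     + (\<Sum>j=1..col_len n lam (a + 1). if i \<ge> t j (a + 1) then 1 else 0)"

definition quasipartition :: "int \<Rightarrow> int \<Rightarrow> nat \<Rightarrow> int list \<Rightarrow> bool" where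
  "quasipartition M p m \<mu> \<longleftrightarrow> length \<mu> = m \<and>
     (m > 0 \<longrightarrow> M \<le> last \<mu> \<and> sorted_wrt (\<ge>) \<mu> \<and> hd \<mu> \<le> p)"

definition extended_RC ::
    "nat \<Rightarrow> (nat \<Rightarrow> nat \<Rightarrow> nat) \<Rightarrow> (nat \<Rightarrow> nat) \<Rightarrow> rigged set" where
  "extended_RC n L lam = {R. shape R \<in> configs n L (tuple_weight n lam) \<and>
     (\<exists>t\<in>tableaux n lam. \<forall>(a, i)\<in>node_set n.
        quasipartition (lower_bound n lam t a i) (vacancy n L (shape R) a i)
          (count (shape R a) i) (labels R a i))}"

end

theory Submission
  imports Defs
begin

text \<open>
  Call a rigged configuration extended if its labels are at most the vacancy numbers and at least
  the lower bounds of some tableau, whose column lengths are read off from the configuration itself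
  (\<open>col_size\<close>) instead of from a prescribed weight. The generated set \<open>RC n L\<close> is the set of all
  extended configurations (\<open>RC_iff_extended\<close>). The theorem is the part of weight \<open>lam\<close> of this
  statement, since the weight and the total size of \<open>lam\<close> determine the column lengths
  (\<open>col_size_eq_col_len\<close>).

  One inclusion is closure. Replace the tableau by the sets \<open>T\<^sub>k\<close> of letters of its columns; with
  \<open>N\<^sub>k i\<close> the number of letters of \<open>T\<^sub>k\<close> up to \<open>i\<close>, the lower bound is \<open>N\<^sub>a\<^sub>+\<^sub>1 i - N\<^sub>a i\<close>. When \<open>f\<^sub>a\<close>
  lengthens a string of length \<open>k\<close>, the labels of longer strings fall by two in \<open>\<nu>\<^sup>(\<^sup>a\<^sup>)\<close> and
  rise by one in its neighbours. The columns are adapted by giving column \<open>a\<close> its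
  smallest free letter beyond \<open>k\<close> and by moving the smallest letter of column \<open>a + 1\<close> beyond \<open>k\<close> to
  the letter that has become available there (\<open>columns_add_box\<close>). The free letter exists because the
  result is required to be valid (\<open>bounded_below_add_box\<close>). The operator \<open>e\<^sub>a\<close> is treated by a reverse
  move (\<open>columns_remove_box\<close>, \<open>bounded_below_remove_box\<close>). A configuration of dominant weight with
  nonnegative labels is extended by columns consisting of their smallest letters
  (\<open>RC_bar_extended\<close>).

  For the other inclusion, \<open>e\<^sub>a\<close> removes a box, is undone by \<open>f\<^sub>a\<close> (\<open>f_op_e_op\<close>), and is defined as
  long as \<open>\<nu>\<^sup>(\<^sup>a\<^sup>)\<close> carries a negative label. An extended configuration without negative labels is of
  highest weight: the vacancy numbers are concave between consecutive parts of \<open>\<nu>\<^sup>(\<^sup>a\<^sup>)\<close> and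
  eventually constant, so that they are nonnegative everywhere if they are so at the parts, and their
  limits are the coefficients of the weight (\<open>highest_weight_RC_bar\<close>).
\<close>

section \<open>Multisets of parts and the vacancy numbers\<close>

definition boxes :: "nat \<Rightarrow> nat multiset \<Rightarrow> int" where
  "boxes i M = (\<Sum>j\<in>#M. int (min i j))"

text \<open>
  The multiplicity array is turned into a family of partitions, so that \<open>L\<close> and \<open>\<nu>\<close> contribute
  to the vacancy numbers through the same function \<open>boxes\<close>.
\<close>

definition lparts :: "nat \<Rightarrow> (nat \<Rightarrow> nat \<Rightarrow> nat) \<Rightarrow> config" where
  "lparts n L a = Abs_multiset (\<lambda>i. if (a, i) \<in> node_set n then L a i else 0)"

definition supported :: "nat \<Rightarrow> (nat \<Rightarrow> 'a multiset) \<Rightarrow> bool" where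
  "supported n M \<longleftrightarrow> (\<forall>a. a \<notin> index_set n \<longrightarrow> M a = {#})"

lemma finite_index_set [simp]: "finite (index_set n)"
  by (rule finite_subset[of _ "{..<n}"]) (auto simp: index_set_def)

lemma count_lparts:
  assumes "multiplicity_array n L"
  shows "count (lparts n L a) i = (if (a, i) \<in> node_set n then L a i else 0)"
proof -
  have "finite {i. 0 < (if (a, i) \<in> node_set n then L a i else 0)}"
  proof (rule finite_subset)
    show "{i. 0 < (if (a, i) \<in> node_set n then L a i else 0)}
        \<subseteq> snd ` {(a, i) \<in> node_set n. L a i \<noteq> 0}"
      by (force split: if_splits)
    show "finite (snd ` {(a, i) \<in> node_set n. L a i \<noteq> 0})"
      using assms unfolding multiplicity_array_def by (rule finite_imageI)
  qed
  then show ?thesis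
    unfolding lparts_def by (subst count_Abs_multiset) auto
qed

lemma sum_count_mult:
  fixes h :: "'a \<Rightarrow> 'b::comm_semiring_1"
  assumes "finite F" "set_mset M \<subseteq> F"
  shows "(\<Sum>j\<in>F. h j * of_nat (count M j)) = (\<Sum>j\<in>#M. h j)"
  using assms(2)
proof (induction M)
  case (add x M)
  have "(\<Sum>j\<in>F. h j * of_nat (count (add_mset x M) j))
      = (\<Sum>j\<in>F. h j * of_nat (count M j) + (if j = x then h j else 0))"
    by (intro sum.cong) (auto simp: algebra_simps)
  also have "\<dots> = (\<Sum>j\<in>#M. h j) + h x"
    using add assms(1) by (simp add: sum.distrib)
  finally show ?case by (simp add: add.commute)
qed simp

lemma sum'_node_set:
  fixes h w :: "nat \<Rightarrow> 'b::comm_semiring_1"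
  assumes "h 0 = 0"
  shows "sum' (\<lambda>(b, j). w b * h j * of_nat (count (M b) j)) (node_set n)
       = (\<Sum>b\<in>index_set n. w b * (\<Sum>j\<in>#M b. h j))"
proof -
  let ?g = "\<lambda>(b, j). w b * h j * of_nat (count (M b) j)"
  let ?F = "(\<Union>b\<in>index_set n. set_mset (M b))"
  have fin: "finite ?F" by simp
  have "sum' ?g (node_set n) = sum' ?g (index_set n \<times> (?F - {0}))"
  proof (rule sum.mono_neutral_right')
    show "index_set n \<times> (?F - {0}) \<subseteq> node_set n"
      by (auto simp: node_set_def)
    show "\<forall>p\<in>node_set n - index_set n \<times> (?F - {0}). ?g p = 0"
    proof
      fix p assume p: "p \<in> node_set n - index_set n \<times> (?F - {0})"
      obtain b j where bj: "p = (b, j)" by fastforce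
      with p have "j \<notin># M b" by (auto simp: node_set_def)
      then show "?g p = 0" by (simp add: bj not_in_iff)
    qed
  qed
  also have "\<dots> = (\<Sum>b\<in>index_set n. \<Sum>j\<in>?F - {0}. w b * h j * of_nat (count (M b) j))"
    using fin by (subst sum.eq_sum) (auto simp: sum.cartesian_product)
  also have "\<dots> = (\<Sum>b\<in>index_set n. w b * (\<Sum>j\<in>#M b. h j))"
  proof (intro sum.cong refl)
    fix b assume b: "b \<in> index_set n"
    have "(\<Sum>j\<in>?F - {0}. w b * h j * of_nat (count (M b) j))
        = (\<Sum>j\<in>?F. w b * h j * of_nat (count (M b) j))"
      using fin assms by (intro sum.mono_neutral_left) auto
    also have "\<dots> = w b * (\<Sum>j\<in>?F. h j * of_nat (count (M b) j))"
      by (simp add: sum_distrib_left mult.assoc)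
    also have "(\<Sum>j\<in>?F. h j * of_nat (count (M b) j)) = (\<Sum>j\<in>#M b. h j)"
      using b fin by (intro sum_count_mult) auto
    finally show "(\<Sum>j\<in>?F - {0}. w b * h j * of_nat (count (M b) j)) = w b * (\<Sum>j\<in>#M b. h j)" .
  qed
  finally show ?thesis .
qed

lemma vacancy_sum:
  assumes L: "multiplicity_array n L" and a: "a \<in> index_set n"
  shows "vacancy n L \<nu> a i
       = boxes i (lparts n L a) - (\<Sum>b\<in>index_set n. cartan a b * boxes i (\<nu> b))"
proof -
  let ?M = "lparts n L a"
  let ?g = "\<lambda>j. int (min i j) * int (L a j)"
  have eq: "count ?M j = L a j" if "1 \<le> j" for j
    using that a by (simp add: count_lparts[OF L] node_set_def)
  have "sum' ?g {j. 1 \<le> j} = sum' ?g (set_mset ?M - {0})"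
    by (rule sum.mono_neutral_right') (auto simp: eq[symmetric] not_in_iff)
  also have "\<dots> = (\<Sum>j\<in>set_mset ?M - {0}. int (min i j) * int (count ?M j))"
    by (subst sum.eq_sum) (auto simp: eq intro!: sum.cong)
  also have "\<dots> = (\<Sum>j\<in>set_mset ?M. int (min i j) * int (count ?M j))"
    by (rule sum.mono_neutral_left) auto
  also have "\<dots> = boxes i ?M"
    unfolding boxes_def by (intro sum_count_mult) auto
  finally show ?thesis
    unfolding vacancy_def boxes_def by (subst sum'_node_set) auto
qed

lemma sum_cartan:
  assumes "a \<in> index_set n" and F: "\<And>b. b \<notin> index_set n \<Longrightarrow> F b = 0"
  shows "(\<Sum>b\<in>index_set n. cartan a b * F b) = 2 * F a - F (a - 1) - F (a + 1)"
proof -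
  have "(\<Sum>b\<in>index_set n. cartan a b * F b)
      = (\<Sum>b\<in>index_set n. (if b = a then 2 * F a else 0) - (if b = a - 1 then F (a - 1) else 0)
          - (if b = a + 1 then F (a + 1) else 0))"
    using assms(1) by (intro sum.cong) (auto simp: cartan_def index_set_def)
  also have "\<dots> = 2 * F a - F (a - 1) - F (a + 1)"
    using assms by (simp add: sum_subtractf)
  finally show ?thesis .
qed

lemma boxes_empty [simp]: "boxes i {#} = 0"
  by (simp add: boxes_def)

lemma boxes_add_mset [simp]: "boxes i (add_mset j M) = int (min i j) + boxes i M"
  by (simp add: boxes_def)

lemma boxes_union [simp]: "boxes i (M + N) = boxes i M + boxes i N"
  by (simp add: boxes_def)

lemma boxes_0 [simp]: "boxes 0 M = 0"
  by (simp add: boxes_def)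

lemma boxes_ge: "(\<And>j. j \<in># M \<Longrightarrow> j \<le> i) \<Longrightarrow> boxes i M = int (\<Sum>\<^sub># M)"
  by (induction M) (auto simp: min_def intro: antisym)

lemma boxes_concave:
  "boxes (Suc (Suc i)) M - boxes (Suc i) M = boxes (Suc i) M - boxes i M - int (count M (Suc i))"
  by (induction M) (auto simp: min_def)

lemma part_le_sum: "j \<in># M \<Longrightarrow> j \<le> \<Sum>\<^sub># M" for M :: "nat multiset"
  by (metis le_add1 multi_member_split sum_mset.add_mset)

lemma vacancy_eq:
  assumes "multiplicity_array n L" "supported n \<nu>" "a \<in> index_set n"
  shows "vacancy n L \<nu> a i
       = boxes i (lparts n L a) - 2 * boxes i (\<nu> a) + boxes i (\<nu> (a - 1)) + boxes i (\<nu> (a + 1))"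
  using assms sum_cartan[of a n "\<lambda>b. boxes i (\<nu> b)"]
  by (simp add: vacancy_sum supported_def)

lemma vacancy_0:
  assumes "multiplicity_array n L" "supported n \<nu>" "a \<in> index_set n"
  shows "vacancy n L \<nu> a 0 = 0"
  by (simp add: vacancy_eq[OF assms])

text \<open>
  Second differences of \<open>boxes\<close> are minus the multiplicities, and only \<open>\<nu>\<^sup>(\<^sup>a\<^sup>)\<close> enters the vacancy
  numbers of \<open>a\<close> with a negative sign.
\<close>

lemma vacancy_concave:
  assumes "multiplicity_array n L" "supported n \<nu>" "a \<in> index_set n" "Suc i \<notin># \<nu> a"
  shows "vacancy n L \<nu> a (Suc (Suc i)) - vacancy n L \<nu> a (Suc i)
       \<le> vacancy n L \<nu> a (Suc i) - vacancy n L \<nu> a i"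
  using assms(4) boxes_concave[of i "lparts n L a"] boxes_concave[of i "\<nu> a"]
    boxes_concave[of i "\<nu> (a - 1)"] boxes_concave[of i "\<nu> (a + 1)"]
  by (simp add: vacancy_eq[OF assms(1-3)] not_in_iff)

text \<open>
  The common value of the vacancy numbers at all large lengths. It is also the coefficient of
  \<open>\<Lambda>\<^sub>a\<close> in the weight.
\<close>

definition vacancy_limit :: "nat \<Rightarrow> (nat \<Rightarrow> nat \<Rightarrow> nat) \<Rightarrow> config \<Rightarrow> nat \<Rightarrow> int" where
  "vacancy_limit n L \<nu> a = int (\<Sum>\<^sub># (lparts n L a)) - 2 * int (\<Sum>\<^sub># (\<nu> a))
     + int (\<Sum>\<^sub># (\<nu> (a - 1))) + int (\<Sum>\<^sub># (\<nu> (a + 1)))"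

lemma vacancy_eventually:
  assumes "multiplicity_array n L" "supported n \<nu>" "a \<in> index_set n"
  shows "\<exists>K. \<forall>i\<ge>K. vacancy n L \<nu> a i = vacancy_limit n L \<nu> a"
proof -
  let ?s = "\<lambda>M. (\<Sum>\<^sub># M :: nat)"
  let ?K = "?s (lparts n L a) + ?s (\<nu> a) + ?s (\<nu> (a - 1)) + ?s (\<nu> (a + 1))"
  have "vacancy n L \<nu> a i = vacancy_limit n L \<nu> a" if "?K \<le> i" for i
  proof -
    have "boxes i M = int (?s M)" if "M \<in> {lparts n L a, \<nu> a, \<nu> (a - 1), \<nu> (a + 1)}" for M
      using \<open>?K \<le> i\<close> that by (intro boxes_ge) (auto dest!: part_le_sum)
    then show ?thesis
      by (simp add: vacancy_eq[OF assms] vacancy_limit_def)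
  qed
  then show ?thesis by blast
qed

text \<open>
  Away from \<open>P\<close> the function \<open>p\<close> is concave. Once it has fallen below \<open>v\<close>, its descent could only
  slow down at an element of \<open>P\<close>; but it meets none before \<open>e\<close>, as the values there are at least \<open>v\<close>.
\<close>

lemma concave_descent:
  fixes p :: "nat \<Rightarrow> int"
  assumes conc: "\<And>i. Suc i \<notin> P \<Longrightarrow> p (Suc (Suc i)) - p (Suc i) \<le> p (Suc i) - p i"
    and start: "v \<le> p k"
    and parts: "\<And>i. i \<in> P \<Longrightarrow> k < i \<Longrightarrow> i < e \<Longrightarrow> v \<le> p i"
    and i: "k < i" "p i < v" "i \<le> e"
  shows "p e \<le> v - 1 - int (e - i)"
proof -
  define m where "m = (LEAST j. k < j \<and> p j < v)"
  have m: "k < m" "p m < v"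
    using LeastI[of "\<lambda>j. k < j \<and> p j < v" i] i unfolding m_def by auto
  have "m \<le> i"
    unfolding m_def using i by (intro Least_le) simp
  have "v \<le> p (m - 1)"
  proof (cases "m - 1 = k")
    case False
    then show ?thesis
      using not_less_Least[of "m - 1" "\<lambda>j. k < j \<and> p j < v"] m(1) unfolding m_def[symmetric]
      by force
  qed (simp add: start)
  have desc: "p j < v \<and> p j < p (j - 1)" if "m \<le> j" "j \<le> e" for j
    using that
  proof (induction j rule: dec_induct)
    case base
    then show ?case using m(2) \<open>v \<le> p (m - 1)\<close> by simp
  next
    case (step j)
    then have IH: "p j < v" "p j < p (j - 1)" and "j \<notin> P"
      using parts[of j] m(1) by force+
    moreover have "Suc (j - 1) = j" using step m(1) by simp
    ultimately show ?case
      using conc[of "j - 1"] by simp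
  qed
  have "p j \<le> v - 1 - int (j - i)" if "i \<le> j" "j \<le> e" for j
    using that
  proof (induction j rule: dec_induct)
    case base
    then show ?case using i(2) by simp
  next
    case (step j)
    then show ?case using desc[of "Suc j"] \<open>m \<le> i\<close> by (simp add: Suc_diff_le)
  qed
  then show ?thesis using i by simp
qed

text \<open>
  Lower bounds for the vacancy numbers at the parts of \<open>\<nu>\<^sup>(\<^sup>a\<^sup>)\<close> extend to all lengths: a value below
  the bound would start a descent that never ends, whereas the vacancy numbers become constant.
\<close>

lemma vacancy_ge_between_parts:
  assumes L: "multiplicity_array n L" "supported n \<nu>" "a \<in> index_set n"
    and start: "v \<le> vacancy n L \<nu> a k"
    and parts: "\<And>i. i \<in># \<nu> a \<Longrightarrow> k < i \<Longrightarrow> v \<le> vacancy n L \<nu> a i"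
    and "k \<le> i"
  shows "v \<le> vacancy n L \<nu> a i"
proof (rule ccontr)
  let ?p = "vacancy n L \<nu> a"
  assume "\<not> v \<le> ?p i"
  then have low: "?p i < v" by simp
  then have "k < i" using start \<open>k \<le> i\<close> by (cases "k = i") auto
  from vacancy_eventually[OF L] obtain K where K: "?p j = vacancy_limit n L \<nu> a" if "K \<le> j" for j
    by blast
  have desc: "?p e \<le> v - 1 - int (e - i)" if "i \<le> e" for e
    using concave_descent[of "set_mset (\<nu> a)" ?p v k e i]
      vacancy_concave[OF L] start parts \<open>k < i\<close> low that by blast
  define e where "e = i + K + nat (v - vacancy_limit n L \<nu> a)"
  have "vacancy_limit n L \<nu> a = ?p e" by (simp add: K e_def)
  moreover have "v - 1 - int (e - i) < vacancy_limit n L \<nu> a" "i \<le> e" by (auto simp: e_def)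
  ultimately show False using desc[of e] by linarith
qed

lemma vacancy_limit_ge:
  assumes L: "multiplicity_array n L" "supported n \<nu>" "a \<in> index_set n"
    and "v \<le> vacancy n L \<nu> a k"
    and "\<And>i. i \<in># \<nu> a \<Longrightarrow> k < i \<Longrightarrow> v \<le> vacancy n L \<nu> a i"
  shows "v \<le> vacancy_limit n L \<nu> a"
proof -
  from vacancy_eventually[OF L] obtain K
    where "vacancy n L \<nu> a (K + k) = vacancy_limit n L \<nu> a" by (metis le_add1)
  with vacancy_ge_between_parts[OF assms, of "K + k"] show ?thesis by simp
qed

section \<open>Columns as sets and how a box moves through them\<close>

definition num_le :: "nat set \<Rightarrow> nat \<Rightarrow> int" where
  "num_le A i = int (card (A \<inter> {..i}))"

lemma num_le_insert:
  assumes "r \<notin> A"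
  shows "num_le (insert r A) i = num_le A i + (if r \<le> i then 1 else 0)"
proof (cases "r \<le> i")
  case True
  then have "insert r A \<inter> {..i} = insert r (A \<inter> {..i})" by auto
  then show ?thesis using True assms by (simp add: num_le_def)
next
  case False
  then have "insert r A \<inter> {..i} = A \<inter> {..i}" by auto
  then show ?thesis using False by (simp add: num_le_def)
qed

lemma num_le_remove:
  assumes "r \<in> A"
  shows "num_le (A - {r}) i = num_le A i - (if r \<le> i then 1 else 0)"
  using num_le_insert[of r "A - {r}" i] assms by (simp add: insert_absorb)

lemma num_le_split:
  assumes "k \<le> i"
  shows "num_le A i = num_le A k + int (card (A \<inter> {k<..i}))"
proof -
  have "A \<inter> {..i} = (A \<inter> {..k}) \<union> (A \<inter> {k<..i})" using assms by auto
  then show ?thesis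
    by (simp add: num_le_def card_Un_disjoint disjoint_iff)
qed

lemma num_le_full: "k \<le> i \<Longrightarrow> {k<..i} \<subseteq> A \<Longrightarrow> num_le A i = num_le A k + int (i - k)"
  using num_le_split[of k i A] by (simp add: Int_absorb1)

lemma num_le_none: "k \<le> i \<Longrightarrow> A \<inter> {k<..i} = {} \<Longrightarrow> num_le A i = num_le A k"
  using num_le_split[of k i A] by simp

lemma num_le_mono: "k \<le> i \<Longrightarrow> num_le A k \<le> num_le A i"
  using num_le_split[of k i A] by simp

lemma num_le_le_add:
  assumes "k \<le> i"
  shows "num_le A i \<le> num_le A k + int (i - k)"
proof -
  have "card (A \<inter> {k<..i}) \<le> i - k"
    using card_mono[of "{k<..i}" "A \<inter> {k<..i}"] by simp
  then show ?thesis using num_le_split[OF assms, of A] by simp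
qed

lemma num_le_ge:
  assumes "A \<subseteq> {..i}"
  shows "num_le A i = int (card A)"
proof -
  have "A \<inter> {..i} = A" using assms by auto
  then show ?thesis by (simp add: num_le_def)
qed

lemma num_le_interval: "num_le {1..m} i = int (min i m)"
proof -
  have "{1..m} \<inter> {..i} = {1..min i m}" by auto
  then show ?thesis by (simp add: num_le_def)
qed

lemma num_le_0: "A \<subseteq> {1..m} \<Longrightarrow> num_le A 0 = 0"
  using num_le_def by (auto simp: num_le_def card_eq_0_iff)

lemma num_le_le_interval:
  assumes "A \<subseteq> {1..m}"
  shows "num_le A i \<le> num_le {1..card A} i"
proof -
  have "card (A \<inter> {..i}) \<le> card {1..i}"
    using assms by (intro card_mono) auto
  moreover have "card (A \<inter> {..i}) \<le> card A"
    using assms by (intro card_mono) (auto intro: finite_subset)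
  ultimately show ?thesis by (auto simp: num_le_interval num_le_def)
qed

text \<open>
  In the two lemmas below \<open>A\<close> and \<open>B\<close> are the columns \<open>a\<close> and \<open>a + 1\<close>, and \<open>C\<close> is the length of column \<open>a\<close>.
  Lengthening a string of length \<open>k\<close> lowers the labels of the longer strings of \<open>\<nu>\<^sup>(\<^sup>a\<^sup>)\<close> by two and
  raises those of its neighbours by one. The lower bounds for \<open>\<nu>\<^sup>(\<^sup>a\<^sup>)\<close> are made to fall by two by
  letting the smallest free letter \<open>r > k\<close> enter column \<open>a\<close> and moving the smallest letter of column
  \<open>a + 1\<close> beyond \<open>k\<close> to the new letter \<open>C + 1\<close>. At lengths where at most one of the changes has taken
  effect, the new bound is below the old bound at \<open>k\<close>; this suffices because all labels beyond \<open>k\<close>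
  exceed the label of the lengthened string. Parts of \<open>\<nu>\<^sup>(\<^sup>a\<^sup>)\<close> have length at most \<open>C\<close>, apart from
  the lengthened one.
\<close>

lemma columns_add_box:
  assumes B: "B \<subseteq> {1..C}"
    and r: "r \<notin> A" "k < r" "{k<..<r} \<subseteq> A"
    and fin: "finite A"
  obtains B' where "card B' = card B" "B' \<subseteq> {1..C + 1}"
    "\<And>i. num_le B' i \<le> num_le B i"
    "\<And>i. num_le B i - (if k < i then 1 else 0) \<le> num_le B' i"
    "\<And>i. k < i \<Longrightarrow> i \<le> C \<or> i = k + 1 \<Longrightarrow>
       num_le B' i - num_le (insert r A) i \<le> num_le B i - num_le A i - 2 \<or>
       num_le B' i - num_le (insert r A) i \<le> num_le B k - num_le A k - 1"
proof (cases "B \<inter> {k<..} = {}")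
  case True
  have "num_le B i - num_le (insert r A) i \<le> num_le B k - num_le A k - 1" if "k < i" for i
  proof -
    have "B \<inter> {k<..i} = {}" using True by auto
    then have eqB: "num_le B i = num_le B k" using that by (simp add: num_le_none)
    show ?thesis
    proof (cases "r \<le> i")
      case True
      then show ?thesis using eqB r(1) num_le_mono[of k i A] that by (simp add: num_le_insert)
    next
      case False
      then have "{k<..i} \<subseteq> A" using r(3) by auto
      then show ?thesis using eqB False r(1) that num_le_full[of k i A] by (simp add: num_le_insert)
    qed
  qed
  moreover have "B \<subseteq> {1..C + 1}" using B by auto
  ultimately show ?thesis by (intro that[of B]) auto
next
  case False
  have finB: "finite B" using B finite_subset by blast
  define s where "s = Min (B \<inter> {k<..})"
  have "s \<in> B \<inter> {k<..}"
    unfolding s_def using False finB by (intro Min_in) auto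
  then have s: "s \<in> B" "k < s" "s \<le> C" using B by auto
  have s_least: "B \<inter> {k<..<s} = {}"
  proof (rule equals0I)
    fix j assume j: "j \<in> B \<inter> {k<..<s}"
    then have "s \<le> j" unfolding s_def using finB by (intro Min_le) auto
    with j show False by simp
  qed
  define B' where "B' = insert (C + 1) (B - {s})"
  have new: "C + 1 \<notin> B - {s}" using B by auto
  have upB: "num_le B' i = num_le B i - (if s \<le> i then 1 else 0) + (if C + 1 \<le> i then 1 else 0)" for i
    using num_le_insert[OF new, of i] num_le_remove[OF s(1), of i] by (simp add: B'_def)
  have upA: "num_le (insert r A) i = num_le A i + (if r \<le> i then 1 else 0)" for i
    using r(1) by (rule num_le_insert)
  show ?thesis
  proof (rule that[of B'])
    show "card B' = card B"
      unfolding B'_def using new finB s(1)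
      by (metis card.remove card_insert_disjoint finite_Diff)
    show "B' \<subseteq> {1..C + 1}" using B by (auto simp: B'_def)
    show "num_le B' i \<le> num_le B i" for i using s by (auto simp: upB)
    show "num_le B i - (if k < i then 1 else 0) \<le> num_le B' i" for i using s by (auto simp: upB)
    show "num_le B' i - num_le (insert r A) i \<le> num_le B i - num_le A i - 2 \<or>
        num_le B' i - num_le (insert r A) i \<le> num_le B k - num_le A k - 1"
      if i: "k < i" "i \<le> C \<or> i = k + 1" for i
    proof -
      have iC: "i \<le> C" using i s by auto
      consider "i < s" "i < r" | "i < s" "r \<le> i" | "s \<le> i" "i < r" | "s \<le> i" "r \<le> i" by linarith
      then show ?thesis
      proof cases
        case 1
        then have "B \<inter> {k<..i} = {}" "{k<..i} \<subseteq> A" using s_least r(3) by auto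
        then show ?thesis
          using num_le_none[of k i B] num_le_full[of k i A] i 1 iC by (simp add: upA upB)
      next
        case 2
        then have "B \<inter> {k<..i} = {}" using s_least by auto
        then show ?thesis
          using num_le_none[of k i B] num_le_mono[of k i A] i 2 iC by (simp add: upA upB)
      next
        case 3
        then have "{k<..i} \<subseteq> A" using r(3) by auto
        then show ?thesis
          using num_le_le_add[of k i B] num_le_full[of k i A] i 3 iC by (simp add: upA upB)
      next
        case 4
        then show ?thesis using iC by (simp add: upA upB)
      qed
    qed
  qed
qed

text \<open>
  The reverse move. Since \<open>B\<close> has fewer letters than \<open>A\<close> among the first \<open>k\<close>, some \<open>r \<le> k\<close> lies in
  \<open>A\<close> and some \<open>u \<le> k\<close> is missing in \<open>B\<close>. The largest \<open>r\<close> is removed from column \<open>a\<close>, and the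
  largest \<open>u\<close> replaces the largest letter of column \<open>a + 1\<close>, unless the latter is already smaller than
  \<open>u\<close>. Parts of \<open>\<nu>\<^sup>(\<^sup>a\<^sup>+\<^sup>1\<^sup>)\<close> have length at most \<open>card B\<close>, so that they do not see the largest letter
  disappear.
\<close>

lemma columns_remove_box:
  assumes A: "A \<subseteq> {1..D}" and B: "B \<subseteq> {1..C}" and k: "k \<le> C"
    and less: "num_le B k < num_le A k"
  obtains r B' where "r \<in> A" "r \<le> k" "card B' = card B" "B' \<subseteq> {1..C - 1}"
    "\<And>i. i \<le> card B \<Longrightarrow> num_le B i + (if k \<le> i then 1 else 0) \<le> num_le B' i"
    "\<And>i. num_le B' i - num_le (A - {r}) i \<le> num_le B i - num_le A i + 2"
    "\<And>i. i < k \<Longrightarrow> num_le B' i - num_le (A - {r}) i \<le> max (num_le B i - num_le A i) (num_le B k - num_le A k + 1)"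
    "\<And>i. Suc i = k \<Longrightarrow> num_le B' i - num_le (A - {r}) i \<le> num_le B k - num_le A k + 1"
proof -
  have finA: "finite A" and finB: "finite B" using A B finite_subset by blast+
  have neA: "A \<inter> {..k} \<noteq> {}"
  proof
    assume "A \<inter> {..k} = {}"
    then have "num_le A k = 0" by (simp add: num_le_def)
    with less show False by (simp add: num_le_def)
  qed
  define r where "r = Max (A \<inter> {..k})"
  have "r \<in> A \<inter> {..k}" unfolding r_def using neA by (intro Max_in) auto
  then have r: "r \<in> A" "r \<le> k" by auto
  have r_great: "A \<inter> {r<..k} = {}"
  proof (rule equals0I)
    fix j assume j: "j \<in> A \<inter> {r<..k}"
    then have "j \<le> r" unfolding r_def by (intro Max_ge) auto
    with j show False by simp
  qed
  have neB: "{1..k} - B \<noteq> {}"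
  proof
    assume "{1..k} - B = {}"
    then have "num_le B k = num_le B 0 + int k" by (intro num_le_full[of 0, simplified]) auto
    moreover have "num_le A k \<le> num_le A 0 + int k" using num_le_le_add[of 0 k A] by simp
    ultimately show False using less num_le_0[OF A] by (simp add: num_le_def)
  qed
  define u where "u = Max ({1..k} - B)"
  have "u \<in> {1..k} - B" unfolding u_def using neB by (intro Max_in) auto
  then have u: "1 \<le> u" "u \<le> k" "u \<notin> B" by auto
  have u_great: "{u<..k} \<subseteq> B"
  proof
    fix j assume j: "j \<in> {u<..k}"
    show "j \<in> B"
    proof (rule ccontr)
      assume "j \<notin> B"
      with j have "j \<in> {1..k} - B" by auto
      then have "j \<le> u" unfolding u_def by (intro Max_ge) auto
      with j show False by simp
    qed
  qed
  have upA: "num_le (A - {r}) i = num_le A i - (if r \<le> i then 1 else 0)" for i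
    using r(1) by (rule num_le_remove)
  define g where "g i = num_le B i - num_le A i" for i
  \<comment> \<open>Between \<open>k\<close> and the larger of \<open>r\<close> and \<open>u\<close>, \<open>g\<close> is below \<open>g k\<close>; down to the smaller one it
     does not exceed \<open>g k\<close>.\<close>
  have both: "g i \<le> g k - 1" if "r \<le> i" "u \<le> i" "i < k" for i
  proof -
    have "{i<..k} \<subseteq> B" "A \<inter> {i<..k} = {}" using that u_great r_great by auto
    then show ?thesis
      using num_le_full[of i k B] num_le_none[of i k A] that by (simp add: g_def)
  qed
  have one: "g i \<le> g k" if "r \<le> i \<or> u \<le> i" "i < k" for i
  proof (cases "r \<le> i")
    case True
    then have "A \<inter> {i<..k} = {}" using r_great by auto
    then show ?thesis
      using num_le_mono[of i k B] num_le_none[of i k A] that by (simp add: g_def)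
  next
    case False
    then have "{i<..k} \<subseteq> B" using that u_great by auto
    then show ?thesis
      using num_le_full[of i k B] num_le_le_add[of i k A] that by (simp add: g_def)
  qed
  have last: "g i \<le> g k + 1" if "Suc i = k" "\<not> r \<le> i" for i
  proof -
    have "num_le A k \<le> num_le A i + 1" using num_le_le_add[of i k A] that by simp
    then show ?thesis using num_le_mono[of i k B] that by (simp add: g_def)
  qed
  have main: "num_le B' i - num_le (A - {r}) i \<le> g i + 2"
    "i < k \<Longrightarrow> num_le B' i - num_le (A - {r}) i \<le> max (g i) (g k + 1)"
    "Suc i = k \<Longrightarrow> num_le B' i - num_le (A - {r}) i \<le> g k + 1"
    if "num_le B' i \<le> num_le B i + (if u \<le> i then 1 else 0)" for B' i
  proof -
    have le: "num_le B' i - num_le (A - {r}) i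
        \<le> g i + (if u \<le> i then 1 else 0) + (if r \<le> i then 1 else 0)"
      using that by (simp add: upA g_def)
    then show "num_le B' i - num_le (A - {r}) i \<le> g i + 2" by (auto split: if_splits)
    show "i < k \<Longrightarrow> num_le B' i - num_le (A - {r}) i \<le> max (g i) (g k + 1)"
      using le both[of i] one[of i] by (auto split: if_splits)
    show "Suc i = k \<Longrightarrow> num_le B' i - num_le (A - {r}) i \<le> g k + 1"
      using le both[of i] one[of i] last[of i]
      by (smt (verit) lessI)
  qed
  show ?thesis
  proof (cases "B \<inter> {u<..} = {}")
    case True
    have small: "i < k" if "i \<le> card B" for i
    proof -
      have "B \<subseteq> {1..u - 1}"
      proof
        fix j assume "j \<in> B"
        then have "j \<noteq> u" "\<not> u < j" "1 \<le> j" using True B u(3) by auto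
        then show "j \<in> {1..u - 1}" by auto
      qed
      then have "card B \<le> u - 1" using card_mono[of "{1..u - 1}" B] by simp
      then show ?thesis using that u by simp
    qed
    show ?thesis
    proof (rule that[of r B])
      show "B \<subseteq> {1..C - 1}"
      proof
        fix j assume "j \<in> B"
        then have "j \<noteq> u" "\<not> u < j" "1 \<le> j" using True B u(3) by auto
        then show "j \<in> {1..C - 1}" using u k by auto
      qed
      show "num_le B i + (if k \<le> i then 1 else 0) \<le> num_le B i" if "i \<le> card B" for i
        using small[OF that] by simp
    qed (use r main[of B, folded g_def] in \<open>auto simp: g_def\<close>)
  next
    case False
    define s where "s = Max B"
    have "B \<noteq> {}" using False by auto
    then have s: "s \<in> B" unfolding s_def using finB by simp
    have s_max: "j \<le> s" if "j \<in> B" for j unfolding s_def using finB that by simp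
    have "u < s" using False s_max by fastforce
    define B' where "B' = insert u (B - {s})"
    have upB: "num_le B' i = num_le B i + (if u \<le> i then 1 else 0) - (if s \<le> i then 1 else 0)" for i
      using num_le_insert[of u "B - {s}" i] num_le_remove[OF s, of i] u(3) by (simp add: B'_def)
    have small: "i < s" if "i \<le> card B" for i
    proof -
      have "B \<subseteq> {1..s} - {u}" using s_max B u(3) by auto
      then have "card B \<le> card ({1..s} - {u})" by (intro card_mono) auto
      also have "\<dots> < s" using u(1) \<open>u < s\<close> by simp
      finally show ?thesis using that by simp
    qed
    show ?thesis
    proof (rule that[of r B'])
      show "card B' = card B"
        unfolding B'_def using u(3) finB s
        by (metis Diff_iff card.remove card_insert_disjoint finite_Diff)
      have "s \<le> C" using s B by auto
      show "B' \<subseteq> {1..C - 1}"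
      proof
        fix j assume "j \<in> B'"
        then have "1 \<le> j" "j < s"
          using u(1) \<open>u < s\<close> B s_max unfolding B'_def by (force simp: order_less_le)+
        then show "j \<in> {1..C - 1}" using \<open>s \<le> C\<close> by auto
      qed
      show "num_le B i + (if k \<le> i then 1 else 0) \<le> num_le B' i" if "i \<le> card B" for i
        using small[OF that] u(2) by (simp add: upB)
    qed (use r main[of B'] in \<open>auto simp: g_def upB\<close>)
  qed
qed

section \<open>Replacing a string\<close>

lemma shape_eq: "shape R b = image_mset fst (R b)"
  by (simp add: shape_def)

lemma in_shape_iff: "i \<in># shape R a \<longleftrightarrow> (\<exists>x. (i, x) \<in># R a)"
  by (force simp: shape_def)

lemma supported_shape [simp]: "supported n (shape R) \<longleftrightarrow> supported n R"
  by (auto simp: supported_def shape_def)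

lemma vacancy_fun_upd:
  assumes L: "multiplicity_array n L" and a: "a \<in> index_set n" and b: "b \<in> index_set n"
  shows "vacancy n L (\<nu>(a := N)) b i
       = vacancy n L \<nu> b i - cartan b a * (boxes i N - boxes i (\<nu> a))"
proof -
  have "(\<Sum>c\<in>index_set n. cartan b c * boxes i ((\<nu>(a := N)) c))
      = (\<Sum>c\<in>index_set n. cartan b c * boxes i (\<nu> c)
          + (if c = a then cartan b a * (boxes i N - boxes i (\<nu> a)) else 0))"
    by (intro sum.cong) (auto simp: algebra_simps)
  also have "\<dots> = (\<Sum>c\<in>index_set n. cartan b c * boxes i (\<nu> c))
      + cartan b a * (boxes i N - boxes i (\<nu> a))"
    using a by (simp add: sum.distrib)
  finally show ?thesis by (simp add: vacancy_sum[OF L b])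
qed

lemma shape_modify:
  assumes "old \<subseteq># R a"
  shows "shape (modify n L R a old new)
       = (shape R)(a := shape R a - image_mset fst old + image_mset fst new)"
proof
  fix b
  obtain N where N: "R a = old + N"
    using assms by (metis subset_mset.add_diff_inverse)
  have "shape (modify n L R a old new) b
      = image_mset fst (if b = a then R a - old + new else R b)"
    by (simp add: modify_def Let_def shape_def multiset.map_comp comp_def case_prod_beta)
  then show "shape (modify n L R a old new) b
      = ((shape R)(a := shape R a - image_mset fst old + image_mset fst new)) b"
    by (auto simp: shape_def N)
qed

lemma modify_eq:
  assumes L: "multiplicity_array n L" and R: "supported n R" and a: "a \<in> index_set n"
    and old: "old \<subseteq># R a"
    and d: "\<And>i. d i = boxes i (image_mset fst new) - boxes i (image_mset fst old)"
  shows "modify n L R a old new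
       = (\<lambda>b. image_mset (\<lambda>(i, x). (i, x - cartan b a * d i)) (if b = a then R a - old else R b)
            + (if b = a then new else {#}))" (is "_ = ?R'")
    and "b \<in> index_set n \<Longrightarrow> vacancy n L (shape (modify n L R a old new)) b i
       = vacancy n L (shape R) b i - cartan b a * d i"
proof -
  obtain N where N: "image_mset fst (R a) = image_mset fst old + N"
    using image_mset_subseteq_mono[OF old] by (metis subset_mset.add_diff_inverse)
  have vac: "vacancy n L ((shape R)(a := shape R a - image_mset fst old + image_mset fst new)) b i
      = vacancy n L (shape R) b i - cartan b a * d i" if "b \<in> index_set n" for b i
    by (subst vacancy_fun_upd[OF L a that]) (simp add: d shape_def N)
  then show "b \<in> index_set n \<Longrightarrow> vacancy n L (shape (modify n L R a old new)) b i
       = vacancy n L (shape R) b i - cartan b a * d i"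
    by (simp add: shape_modify[of old R a, OF old])
  have sh: "shape ((R(a := R a - old)) (a := (R(a := R a - old)) a + new))
      = (shape R)(a := shape R a - image_mset fst old + image_mset fst new)"
  proof -
    obtain S where "R a = old + S"
      using old by (metis subset_mset.add_diff_inverse)
    then show ?thesis by (auto simp: shape_def fun_eq_iff)
  qed
  show "modify n L R a old new = ?R'"
  proof
    fix b
    show "modify n L R a old new b = ?R' b"
    proof (cases "b \<in> index_set n")
      case True
      then show ?thesis
        unfolding modify_def Let_def sh by (auto simp: vac)
    next
      case False
      then have "R b = {#}" "b \<noteq> a" using R a by (auto simp: supported_def)
      then show ?thesis by (simp add: modify_def Let_def)
    qed
  qed
qed

lemma supported_modify:
  assumes "supported n R" "a \<in> index_set n"
  shows "supported n (modify n L R a old new)"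
  using assms by (auto simp: supported_def modify_def Let_def)

text \<open>
  The label changes of the remaining strings depend only on how the replaced string alters the
  \<open>boxes\<close>, so exchanging the two strings again undoes them.
\<close>

lemma modify_inverse:
  assumes L: "multiplicity_array n L" and R: "supported n R" and a: "a \<in> index_set n"
    and old: "old \<subseteq># R a"
  shows "modify n L (modify n L R a old new) a new old = R"
proof -
  let ?R' = "modify n L R a old new"
  define d where "d i = boxes i (image_mset fst new) - boxes i (image_mset fst old)" for i
  have R': "?R' = (\<lambda>b. image_mset (\<lambda>(i, x). (i, x - cartan b a * d i))
      (if b = a then R a - old else R b) + (if b = a then new else {#}))"
    by (rule modify_eq(1)[OF L R a old]) (simp add: d_def)
  have "new \<subseteq># ?R' a" by (simp add: R')
  then have R'': "modify n L ?R' a new old = (\<lambda>b. image_mset (\<lambda>(i, x). (i, x - cartan b a * (- d i)))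
      (if b = a then ?R' a - new else ?R' b) + (if b = a then old else {#}))"
    by (intro modify_eq(1)[OF L supported_modify[OF R a] a]) (auto simp: d_def)
  show ?thesis
  proof
    fix b
    have "(\<lambda>(i, x). (i, x - cartan b a * (- d i))) \<circ> (\<lambda>(i, x). (i, x - cartan b a * d i)) = id"
      by auto
    then have undo: "image_mset (\<lambda>(i, x). (i, x - cartan b a * (- d i)))
        (image_mset (\<lambda>(i, x). (i, x - cartan b a * d i)) M) = M" for M
      by (simp only: multiset.map_comp) simp
    show "modify n L ?R' a new old b = R b"
      unfolding R'' unfolding R' using old undo by auto
  qed
qed

section \<open>Lower bounds from columns\<close>

text \<open>
  The length of column \<open>k\<close>, expressed through \<open>\<nu>\<close> and \<open>L\<close> instead of the weight. The difference
  \<open>b - k\<close> is 0 for \<open>b \<le> k\<close>.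
\<close>

definition col_size :: "nat \<Rightarrow> (nat \<Rightarrow> nat \<Rightarrow> nat) \<Rightarrow> config \<Rightarrow> nat \<Rightarrow> nat" where
  "col_size n L \<nu> k = \<Sum>\<^sub># (\<nu> k) + (\<Sum>b\<in>index_set n. (b - k) * \<Sum>\<^sub># (lparts n L b))"

text \<open>
  A strictly decreasing column is the same as its set of letters. The case distinction is the
  convention \<open>c\<^sub>0 = c\<^sub>1\<close>.
\<close>

definition columns :: "nat \<Rightarrow> (nat \<Rightarrow> nat) \<Rightarrow> (nat \<Rightarrow> nat set) \<Rightarrow> bool" where
  "columns n c T \<longleftrightarrow>
     (\<forall>k\<in>index_set n. T k \<subseteq> {1..c (if k = 1 then 1 else k - 1)} \<and> card (T k) = c k) \<and>
     (\<forall>k. k \<notin> index_set n \<longrightarrow> T k = {})"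

definition lower :: "(nat \<Rightarrow> nat set) \<Rightarrow> nat \<Rightarrow> nat \<Rightarrow> int" where
  "lower T a i = num_le (T (a + 1)) i - num_le (T a) i"

definition valid :: "nat \<Rightarrow> (nat \<Rightarrow> nat \<Rightarrow> nat) \<Rightarrow> rigged \<Rightarrow> bool" where
  "valid n L R \<longleftrightarrow> supported n R \<and>
     (\<forall>a i x. (i, x) \<in># R a \<longrightarrow> 0 < i \<and> x \<le> vacancy n L (shape R) a i)"

definition bounded_below :: "nat \<Rightarrow> (nat \<Rightarrow> nat \<Rightarrow> nat) \<Rightarrow> rigged \<Rightarrow> (nat \<Rightarrow> nat set) \<Rightarrow> bool" where
  "bounded_below n L R T \<longleftrightarrow> columns n (col_size n L (shape R)) T \<and>
     (\<forall>a i x. (i, x) \<in># R a \<longrightarrow> lower T a i \<le> x)"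

text \<open>
  The function \<open>k \<mapsto> max (b - k) 0\<close> has second difference 1 at \<open>b\<close> and 0 elsewhere, and the vacancy
  numbers in the limit are second differences of the sizes of the partitions up to the contribution
  of \<open>L\<close>. So the weight and the column lengths determine each other up to boundary values.
\<close>

lemma col_size_second_difference:
  assumes a: "a \<in> index_set n"
  shows "vacancy_limit n L \<nu> a
       = int (col_size n L \<nu> (a - 1)) - 2 * int (col_size n L \<nu> a) + int (col_size n L \<nu> (a + 1))"
proof -
  define s where "s b = int (\<Sum>\<^sub># (lparts n L b))" for b
  define D where "D k = (\<Sum>b\<in>index_set n. int (b - k) * s b)" for k
  have size: "int (col_size n L \<nu> k) = int (\<Sum>\<^sub># (\<nu> k)) + D k" for k
    by (simp add: col_size_def D_def s_def)
  have "D (a - 1) - 2 * D a + D (a + 1)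
      = (\<Sum>b\<in>index_set n. int (b - (a - 1)) * s b - 2 * (int (b - a) * s b) + int (b - (a + 1)) * s b)"
    by (simp only: D_def sum.distrib sum_subtractf sum_distrib_left)
  also have "\<dots> = (\<Sum>b\<in>index_set n. if b = a then s a else 0)"
  proof (intro sum.cong refl)
    fix b
    have "int (b - (a - 1)) - 2 * int (b - a) + int (b - (a + 1)) = (if b = a then 1 else 0)"
      using a by (auto simp: index_set_def)
    then have "(int (b - (a - 1)) - 2 * int (b - a) + int (b - (a + 1))) * s b
        = (if b = a then 1 else 0) * s b"
      by simp
    then show "int (b - (a - 1)) * s b - 2 * (int (b - a) * s b) + int (b - (a + 1)) * s b
        = (if b = a then s a else 0)"
      by (auto simp: algebra_simps)
  qed
  also have "\<dots> = s a" using a by simp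
  finally show ?thesis
    unfolding size vacancy_limit_def by (simp add: s_def)
qed

lemma part_le_col_size:
  assumes "(i, x) \<in># R a"
  shows "i \<le> col_size n L (shape R) a"
proof -
  have "i \<in># shape R a" using assms by (auto simp: in_shape_iff)
  from part_le_sum[OF this] show ?thesis by (simp add: col_size_def)
qed

lemma columns_next:
  assumes "columns n c T" "a \<in> index_set n"
  shows "T (a + 1) \<subseteq> {1..c a}"
proof (cases "a + 1 \<in> index_set n")
  case True
  then have "T (a + 1) \<subseteq> {1..c (if a + 1 = 1 then 1 else a + 1 - 1)}"
    using assms(1) unfolding columns_def by blast
  then show ?thesis using assms(2) by (simp add: index_set_def)
next
  case False
  then show ?thesis using assms(1) by (simp add: columns_def)
qed

lemma columns_subset:
  assumes "columns n c T"
  shows "\<exists>m. T k \<subseteq> {1..m}"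
  using assms unfolding columns_def by (metis empty_subsetI)

lemma lower_0: "columns n c T \<Longrightarrow> lower T a 0 = 0"
  using columns_subset[of n c T a] columns_subset[of n c T "a + 1"] by (auto simp: lower_def num_le_0)

lemma col_size_fun_upd:
  "b \<noteq> a \<Longrightarrow> col_size n L (\<nu>(a := N)) b = col_size n L \<nu> b"
  "col_size n L (\<nu>(a := N)) a + \<Sum>\<^sub># (\<nu> a) = col_size n L \<nu> a + \<Sum>\<^sub># N"
  by (auto simp: col_size_def)

section \<open>Invariance under the crystal operators\<close>

lemma cartan_cases:
  assumes "b \<in> index_set n" "a \<in> index_set n"
  obtains "b = a" "cartan b a = 2" | "b = a + 1" "cartan b a = - 1"
    | "a = b + 1" "b \<noteq> a" "cartan b a = - 1"
    | "b \<noteq> a" "b \<noteq> a + 1" "a \<noteq> b + 1" "cartan b a = 0"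
proof -
  consider "b = a" | "b = a + 1" | "a = b + 1" | "b \<noteq> a" "b \<noteq> a + 1" "a \<noteq> b + 1" by blast
  then show ?thesis by cases (use that in \<open>simp_all add: cartan_def\<close>)
qed

text \<open>
  Adding a box to a string of length \<open>k\<close>, where \<open>k = x = 0\<close> stands for creating a string of length
  one. The free letter needed in column \<open>a\<close> exists because the vacancy number of \<open>a\<close> exceeds \<open>x\<close>
  beyond \<open>k\<close>: at the new string this is the bound on its label, at the longer strings it follows
  from the choice of \<open>k\<close>, and hence it holds in the limit, where the vacancy number is a second
  difference of column lengths. For \<open>a = 1\<close> the letter \<open>c\<^sub>1 + 1\<close> becomes available.
\<close>

lemma bounded_below_add_box:
  assumes L: "multiplicity_array n L" and a: "a \<in> index_set n"
    and R: "valid n L R" "bounded_below n L R T"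
    and old: "(k, x) \<in># R a \<and> old = {#(k, x)#} \<or> k = 0 \<and> x = 0 \<and> old = {#}"
    and min: "\<And>i y. (i, y) \<in># R a \<Longrightarrow> x \<le> y \<and> (k < i \<longrightarrow> x < y)"
    and R': "R' = modify n L R a old {#(k + 1, x - 1)#}"
    and upper: "\<And>b i y. b \<in> index_set n \<Longrightarrow> (i, y) \<in># R' b \<Longrightarrow> y \<le> vacancy n L (shape R') b i"
  shows "valid n L R' \<and> (\<exists>T'. bounded_below n L R' T')"
proof -
  let ?c = "col_size n L (shape R)" and ?c' = "col_size n L (shape R')"
  let ?d = "\<lambda>i. if k < i then 1 else 0 :: int"
  have sup: "supported n R" and cols: "columns n ?c T"
    using R by (simp_all add: valid_def bounded_below_def)
  have pos: "0 < i" and upper_R: "y \<le> vacancy n L (shape R) b i" and low: "lower T b i \<le> y"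
    if "(i, y) \<in># R b" for b i y
    using R that unfolding valid_def bounded_below_def by blast+
  have sub: "old \<subseteq># R a" using old by auto
  have d: "?d i = boxes i (image_mset fst {#(k + 1, x - 1)#}) - boxes i (image_mset fst old)" for i
    using old by auto
  have R'_eq: "R' = (\<lambda>b. image_mset (\<lambda>(i, y). (i, y - cartan b a * ?d i))
      (if b = a then R a - old else R b) + (if b = a then {#(k + 1, x - 1)#} else {#}))"
    unfolding R' by (rule modify_eq(1)[OF L sup a sub]) (rule d)
  have vac: "vacancy n L (shape R') b i = vacancy n L (shape R) b i - cartan b a * ?d i"
    if "b \<in> index_set n" for b i
    unfolding R' by (rule modify_eq(2)[OF L sup a sub _ that]) (rule d)
  have sh: "shape R' = (shape R)(a := shape R a - image_mset fst old + {#k + 1#})"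
    using shape_modify[of old R a n L "{#(k + 1, x - 1)#}", OF sub] by (simp add: R')
  have sup': "supported n R'" unfolding R' by (rule supported_modify[OF sup a])
  have strings: "(b = a \<and> i = k + 1 \<and> y = x - 1) \<or>
      (\<exists>z. (i, z) \<in># R b \<and> y = z - cartan b a * ?d i)" if "(i, y) \<in># R' b" for b i y
    using that unfolding R'_eq by (auto split: if_splits dest: in_diffD)
  have new: "(k + 1, x - 1) \<in># R' a" by (simp add: R'_eq)
  have "valid n L R'"
    unfolding valid_def
  proof (intro conjI allI impI)
    fix b i y assume iy: "(i, y) \<in># R' b"
    then have "b \<in> index_set n" using sup' by (force simp: supported_def)
    then show "y \<le> vacancy n L (shape R') b i" using upper iy by blast
    show "0 < i" using strings[OF iy] pos by auto
  qed (rule sup')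

  have c'_a: "?c' a = ?c a + 1"
  proof -
    obtain N where "shape R a = image_mset fst old + N"
      using image_mset_subseteq_mono[OF sub, of fst] unfolding shape_eq
      by (metis subset_mset.add_diff_inverse)
    then show ?thesis
      using old col_size_fun_upd(2)[of n L "shape R" a "shape R a - image_mset fst old + {#k + 1#}"]
      unfolding sh by auto
  qed
  have c'_other: "?c' b = ?c b" if "b \<noteq> a" for b
    unfolding sh using that by (rule col_size_fun_upd(1))

  have T_next: "T (a + 1) \<subseteq> {1..?c a}" using columns_next[OF cols a] .
  have T_a: "T a \<subseteq> {1..?c (if a = 1 then 1 else a - 1)}" "card (T a) = ?c a"
    using cols a by (auto simp: columns_def)
  have finT: "finite (T a)" using T_a(1) finite_subset by blast
  have k_le: "k \<le> ?c a" using old part_le_col_size by auto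
  have low_k: "lower T a k \<le> x" using old low lower_0[OF cols] by auto
  define r where "r = (LEAST r. k < r \<and> r \<notin> T a)"
  have ex: "\<exists>r. k < r \<and> r \<notin> T a"
    using T_a(1) by (intro exI[of _ "k + ?c (if a = 1 then 1 else a - 1) + 1"]) auto
  have r: "k < r" "r \<notin> T a" using LeastI_ex[OF ex] by (auto simp: r_def)
  have r_least: "{k<..<r} \<subseteq> T a"
    using not_less_Least[of _ "\<lambda>r. k < r \<and> r \<notin> T a"] by (auto simp: r_def[symmetric])
  have r_le: "r \<le> ?c' (if a = 1 then 1 else a - 1)"
  proof (cases "a = 1")
    case True
    have "r \<le> ?c 1 + 1"
      unfolding r_def using T_a k_le True by (intro Least_le) auto
    then show ?thesis using True c'_a by simp
  next
    case False
    have "x - 1 \<le> vacancy n L (shape R') a (k + 1)" using upper[OF a new] .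
    then have "x + 1 \<le> vacancy n L (shape R) a (k + 1)"
      by (simp add: vac[OF a] cartan_def)
    moreover have "x + 1 \<le> vacancy n L (shape R) a i" if "i \<in># shape R a" "k + 1 < i" for i
      using that min upper_R by (force simp: in_shape_iff)
    ultimately have "x + 1 \<le> vacancy_limit n L (shape R) a"
      using L sup a by (intro vacancy_limit_ge[of n L _ a _ "k + 1"]) auto
    then have limit: "x + 1 \<le> int (?c (a - 1)) - 2 * int (?c a) + int (?c (a + 1))"
      using col_size_second_difference[OF a, of L "shape R"] by simp
    have "r \<le> ?c (a - 1)"
    proof (rule ccontr)
      assume "\<not> r \<le> ?c (a - 1)"
      then have full: "{k<..?c (a - 1)} \<subseteq> T a" using r_least by auto
      have sub_a: "T a \<subseteq> {1..?c (a - 1)}" using T_a(1) False by simp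
      have "?c a \<le> ?c (a - 1)" using card_mono[OF _ sub_a] T_a(2) by simp
      then have "num_le (T a) (?c (a - 1)) = num_le (T a) k + int (?c (a - 1) - k)"
        using full k_le by (intro num_le_full) auto
      moreover have "num_le (T a) (?c (a - 1)) = int (?c a)"
        using num_le_ge[of "T a" "?c (a - 1)"] sub_a T_a(2) by (simp add: subset_iff)
      moreover have "num_le (T (a + 1)) (?c a) = int (?c (a + 1))"
      proof -
        have "card (T (a + 1)) = ?c (a + 1)"
        proof (cases "a + 1 \<in> index_set n")
          case True
          then show ?thesis using cols by (simp add: columns_def)
        next
          case False
          then have "?c (a + 1) = 0" 
            using sup a by (auto simp: col_size_def supported_def index_set_def shape_def)
          then show ?thesis using cols False by (simp add: columns_def)
        qed
        then show ?thesis
          using num_le_ge[of "T (a + 1)" "?c a"] T_next by (simp add: subset_iff)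
      qed
      moreover have "num_le (T (a + 1)) (?c a) \<le> num_le (T (a + 1)) k + int (?c a - k)"
        using k_le by (rule num_le_le_add)
      ultimately show False
        using limit low_k k_le \<open>?c a \<le> ?c (a - 1)\<close> unfolding lower_def by linarith
    qed
    moreover have "a - 1 \<noteq> a" using a by (auto simp: index_set_def)
    ultimately show ?thesis using False c'_other[of "a - 1"] by simp
  qed

  obtain B' where B': "card B' = card (T (a + 1))" "B' \<subseteq> {1..?c a + 1}"
      "\<And>i. num_le B' i \<le> num_le (T (a + 1)) i"
      "\<And>i. num_le (T (a + 1)) i - ?d i \<le> num_le B' i"
      "\<And>i. k < i \<Longrightarrow> i \<le> ?c a \<or> i = k + 1 \<Longrightarrow>
         num_le B' i - num_le (insert r (T a)) i \<le> num_le (T (a + 1)) i - num_le (T a) i - 2 \<or>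
         num_le B' i - num_le (insert r (T a)) i \<le> num_le (T (a + 1)) k - num_le (T a) k - 1"
    using columns_add_box[OF T_next r(2,1) r_least finT] by metis
  define T' where "T' = T(a := insert r (T a), a + 1 := B')"
  have T'_simps: "T' a = insert r (T a)" "T' (Suc a) = B'" "b \<noteq> a \<Longrightarrow> b \<noteq> a + 1 \<Longrightarrow> T' b = T b" for b
    by (auto simp: T'_def)
  have up_a: "num_le (T' a) i = num_le (T a) i + (if r \<le> i then 1 else 0)" for i
    using r(2) by (simp add: T'_simps num_le_insert)
  have "columns n ?c' T'"
    unfolding columns_def
  proof (intro conjI ballI allI impI)
    fix b assume b: "b \<in> index_set n"
    have T_b: "T b \<subseteq> {1..?c (if b = 1 then 1 else b - 1)}" "card (T b) = ?c b"
      using cols b by (auto simp: columns_def)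
    have mono: "?c i \<le> ?c' i" for i using c'_a c'_other[of i] by (cases "i = a") auto
    show "T' b \<subseteq> {1..?c' (if b = 1 then 1 else b - 1)}"
    proof (cases "b = a \<or> b = a + 1")
      case True
      have "{1..?c (if a = 1 then 1 else a - 1)} \<subseteq> {1..?c' (if a = 1 then 1 else a - 1)}"
        using mono by auto
      then have "insert r (T a) \<subseteq> {1..?c' (if a = 1 then 1 else a - 1)}"
        using T_a(1) r_le r(1) by auto
      moreover have "a + 1 \<noteq> 1" using a by (simp add: index_set_def)
      ultimately show ?thesis using True B'(2) c'_a T'_simps by auto
    next
      case False
      then show ?thesis
        using T_b(1) mono[of "if b = 1 then 1 else b - 1"] T'_simps(3)[of b] by auto
    qed
    show "card (T' b) = ?c' b"
    proof (cases "b = a")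
      case True
      then show ?thesis using T_a(2) finT r(2) c'_a by (simp add: T'_simps)
    next
      case False
      then have "card (T' b) = card (T b)"
        using B'(1) T'_simps by (cases "b = a + 1") simp_all
      then show ?thesis using T_b(2) c'_other[OF False] by simp
    qed
  next
    fix b assume b: "b \<notin> index_set n"
    then have "T b = {}" "b \<noteq> a" using cols a by (auto simp: columns_def)
    moreover have "b = a + 1 \<Longrightarrow> B' = {}"
      using B'(1,2) \<open>T b = {}\<close> finite_subset by fastforce
    ultimately show "T' b = {}" using T'_simps by (cases "b = a + 1") auto
  qed
  moreover have "lower T' b i \<le> y" if iy: "(i, y) \<in># R' b" for b i y
  proof -
    have b: "b \<in> index_set n" using iy sup' by (force simp: supported_def)
    have B'_up: "num_le (T' (a + 1)) i \<le> num_le (T (a + 1)) i"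
      "num_le (T (a + 1)) i - ?d i \<le> num_le (T' (a + 1)) i"
      using B'(3,4) by (auto simp: T'_simps)
    have decrease: "lower T' a i \<le> lower T a i - 2 \<or> lower T' a i \<le> lower T a k - 1"
      if "k < i" "i \<le> ?c a \<or> i = k + 1"
      using B'(5)[OF that] by (simp add: lower_def T'_simps)
    from strings[OF iy] show ?thesis
    proof (elim disjE exE conjE)
      assume "b = a" "i = k + 1" "y = x - 1"
      moreover have "lower T a (k + 1) \<le> lower T a k + 1"
        using num_le_le_add[of k "k + 1" "T (a + 1)"] num_le_mono[of k "k + 1" "T a"]
        by (simp add: lower_def)
      ultimately show ?thesis using decrease low_k by auto
    next
      fix z assume z: "(i, z) \<in># R b" "y = z - cartan b a * ?d i"
      have low_z: "lower T b i \<le> z" using low[OF z(1)] .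
      from b a show ?thesis
      proof (cases rule: cartan_cases)
        case 1
        show ?thesis
        proof (cases "k < i")
          case True
          have "i \<le> ?c a" using z 1 part_le_col_size by auto
          then show ?thesis
            using decrease[OF True] z 1 True low_z min[of i z] low_k by auto
        next
          case False
          then show ?thesis
            using low_z z 1 B'_up(1) up_a[of i] by (auto simp: lower_def)
        qed
      next
        case 2
        have "T' (b + 1) = T (b + 1)" using 2 T'_simps(3)[of "b + 1"] by simp
        then show ?thesis
          using low_z z 2 B'_up(2) by (auto simp: lower_def)
      next
        case 3
        have "T' b = T b" using 3 T'_simps(3)[of b] by simp
        then show ?thesis
          using low_z z 3 up_a[of i] r(1) by (auto simp: lower_def)
      next
        case 4
        then have "lower T' b i = lower T b i" using T'_simps(3)[of b] T'_simps(3)[of "b + 1"]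
          by (simp add: lower_def)
        then show ?thesis using low_z z 4 by simp
      qed
    qed
  qed
  ultimately show ?thesis using \<open>valid n L R'\<close> by (auto simp: bounded_below_def)
qed

text \<open>
  Removing a box from a string of length \<open>k\<close> with negative label \<open>x\<close>, where \<open>x\<close> is minimal and \<open>k\<close>
  is minimal for it. Column 1 is special: it must consist of all available letters, so its largest
  letter disappears whatever letter \<open>r\<close> the general move suggests; compared with that
  move, the bounds for \<open>\<nu>\<^sup>(\<^sup>1\<^sup>)\<close> can only become lower. The shortened string respects its upper bound, since otherwise concavity would make
  the vacancy number drop below \<open>x\<close> at \<open>k\<close>.
\<close>

lemma bounded_below_remove_box:
  assumes L: "multiplicity_array n L" and a: "a \<in> index_set n"
    and R: "valid n L R" "bounded_below n L R T"
    and kx: "(k, x) \<in># R a" "x < 0"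
    and min: "\<And>i y. (i, y) \<in># R a \<Longrightarrow> x \<le> y \<and> (i < k \<longrightarrow> x < y)"
    and R': "R' = modify n L R a {#(k, x)#} (if k = 1 then {#} else {#(k - 1, x + 1)#})"
  shows "valid n L R' \<and> (\<exists>T'. bounded_below n L R' T')" and "k = 1 \<longrightarrow> x = - 1"
proof -
  let ?c = "col_size n L (shape R)" and ?c' = "col_size n L (shape R')"
  let ?new = "if k = 1 then {#} else {#(k - 1, x + 1)#}"
  let ?d = "\<lambda>i. if k \<le> i then - 1 else 0 :: int"
  have sup: "supported n R" and cols: "columns n ?c T"
    using R by (simp_all add: valid_def bounded_below_def)
  have pos: "0 < i" and upper_R: "y \<le> vacancy n L (shape R) b i" and low: "lower T b i \<le> y"
    if "(i, y) \<in># R b" for b i y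
    using R that unfolding valid_def bounded_below_def by blast+
  have k_pos: "0 < k" using pos[OF kx(1)] .
  have sub: "{#(k, x)#} \<subseteq># R a" using kx by simp
  have d: "?d i = boxes i (image_mset fst ?new) - boxes i (image_mset fst {#(k, x)#})" for i
    using k_pos by auto
  have R'_eq: "R' = (\<lambda>b. image_mset (\<lambda>(i, y). (i, y - cartan b a * ?d i))
      (if b = a then R a - {#(k, x)#} else R b) + (if b = a then ?new else {#}))"
    unfolding R' by (rule modify_eq(1)[OF L sup a sub]) (rule d)
  have vac: "vacancy n L (shape R') b i = vacancy n L (shape R) b i - cartan b a * ?d i"
    if "b \<in> index_set n" for b i
    unfolding R' by (rule modify_eq(2)[OF L sup a sub _ that]) (rule d)
  have sh: "shape R' = (shape R)(a := shape R a - {#k#} + image_mset fst ?new)"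
    using shape_modify[of "{#(k, x)#}" R a n L ?new, OF sub] by (simp add: R')
  have sup': "supported n R'" unfolding R' by (rule supported_modify[OF sup a])
  have strings: "(b = a \<and> k \<noteq> 1 \<and> i = k - 1 \<and> y = x + 1) \<or>
      (\<exists>z. (i, z) \<in># R b \<and> y = z - cartan b a * ?d i)" if "(i, y) \<in># R' b" for b i y
    using that unfolding R'_eq by (auto split: if_splits dest: in_diffD)

  have low_k: "num_le (T (a + 1)) k - num_le (T a) k \<le> x" using low[OF kx(1)] by (simp add: lower_def)
  have T_0: "num_le (T b) 0 = 0" for b using columns_subset[OF cols, of b] num_le_0 by blast
  show "k = 1 \<longrightarrow> x = - 1"
  proof
    assume "k = 1"
    then have "- 1 \<le> x"
      using low_k num_le_le_add[of 0 1 "T a"] num_le_mono[of 0 1 "T (a + 1)"] by (simp add: T_0)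
    then show "x = - 1" using kx by simp
  qed

  have "valid n L R'"
    unfolding valid_def
  proof (intro conjI allI impI)
    fix b i y assume iy: "(i, y) \<in># R' b"
    then have b: "b \<in> index_set n" using sup' by (force simp: supported_def)
    show "0 < i" using strings[OF iy] pos k_pos by auto
    from strings[OF iy] show "y \<le> vacancy n L (shape R') b i"
    proof (elim disjE exE conjE)
      assume new: "b = a" "k \<noteq> 1" "i = k - 1" "y = x + 1"
      have "x + 1 \<le> vacancy n L (shape R) a (k - 1)"
      proof (rule ccontr)
        assume "\<not> ?thesis"
        then have less: "vacancy n L (shape R) a (k - 1) < x + 1" by simp
        have "vacancy n L (shape R) a k \<le> x + 1 - 1 - int (k - (k - 1))"
        proof (rule concave_descent[of "set_mset (shape R a)"])
          show "vacancy n L (shape R) a (Suc (Suc j)) - vacancy n L (shape R) a (Suc j)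
              \<le> vacancy n L (shape R) a (Suc j) - vacancy n L (shape R) a j"
            if "Suc j \<notin># shape R a" for j
            using vacancy_concave[of n L "shape R" a j] L sup a that by simp
          show "x + 1 \<le> vacancy n L (shape R) a 0"
            using vacancy_0[OF L _ a, of "shape R"] sup kx(2) by simp
          show "x + 1 \<le> vacancy n L (shape R) a j" if "j \<in># shape R a" "j < k" for j
          proof -
            obtain z where z: "(j, z) \<in># R a" using \<open>j \<in># shape R a\<close> in_shape_iff by blast
            then have "x < z" using min[OF z] \<open>j < k\<close> by simp
            then show ?thesis using upper_R[OF z] by linarith
          qed
        qed (use k_pos new(2) less in auto)
        then show False using upper_R[OF kx(1)] k_pos by simp
      qed
      moreover have "\<not> k \<le> k - 1" using k_pos by simp
      ultimately show ?thesis using new vac[OF b, of i] by simp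
    next
      fix z assume "(i, z) \<in># R b" "y = z - cartan b a * ?d i"
      then show ?thesis using upper_R vac[OF b, of i] by simp
    qed
  qed (rule sup')

  have c'_a: "?c' a + 1 = ?c a"
  proof -
    obtain N where "shape R a = add_mset k N"
      using kx(1) multi_member_split[of k "shape R a"] in_shape_iff by blast
    then show ?thesis
      using k_pos col_size_fun_upd(2)[of n L "shape R" a "shape R a - {#k#} + image_mset fst ?new"]
      unfolding sh by (auto split: if_splits)
  qed
  have c'_other: "?c' b = ?c b" if "b \<noteq> a" for b
    unfolding sh using that by (rule col_size_fun_upd(1))

  have T_next: "T (a + 1) \<subseteq> {1..?c a}" using columns_next[OF cols a] .
  have T_a: "T a \<subseteq> {1..?c (if a = 1 then 1 else a - 1)}" "card (T a) = ?c a"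
    using cols a by (auto simp: columns_def)
  have finT: "finite (T a)" using T_a(1) finite_subset by blast
  have k_le: "k \<le> ?c a" using kx(1) by (rule part_le_col_size)
  have less: "num_le (T (a + 1)) k < num_le (T a) k" using low_k kx(2) by simp
  obtain r B' where B': "r \<in> T a" "r \<le> k" "card B' = card (T (a + 1))" "B' \<subseteq> {1..?c a - 1}"
      "\<And>i. i \<le> card (T (a + 1)) \<Longrightarrow> num_le (T (a + 1)) i + (if k \<le> i then 1 else 0) \<le> num_le B' i"
      "\<And>i. num_le B' i - num_le (T a - {r}) i \<le> num_le (T (a + 1)) i - num_le (T a) i + 2"
      "\<And>i. i < k \<Longrightarrow> num_le B' i - num_le (T a - {r}) i
         \<le> max (num_le (T (a + 1)) i - num_le (T a) i) (num_le (T (a + 1)) k - num_le (T a) k + 1)"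
      "\<And>i. Suc i = k \<Longrightarrow> num_le B' i - num_le (T a - {r}) i
         \<le> num_le (T (a + 1)) k - num_le (T a) k + 1"
    using columns_remove_box[OF T_a(1) T_next k_le less] by metis
  define A' where "A' = (if a = 1 then {1..?c a - 1} else T a - {r})"
  have card_A': "card A' = ?c a - 1"
    using B'(1) finT T_a(2) by (simp add: A'_def)
  have A'_ge: "num_le (T a - {r}) i \<le> num_le A' i" for i
  proof (cases "a = 1")
    case True
    have "card (T a - {r}) = ?c a - 1" using B'(1) finT T_a(2) by simp
    then show ?thesis
      using num_le_le_interval[of "T a - {r}" "?c (if a = 1 then 1 else a - 1)" i] T_a(1) True
      by (auto simp: A'_def)
  qed (simp add: A'_def)
  have A'_le: "num_le A' i \<le> num_le (T a) i - (if k \<le> i then 1 else 0)" if "a \<noteq> 1" for i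
    using that num_le_remove[OF B'(1), of i] B'(2) by (simp add: A'_def)
  define T' where "T' = T(a := A', a + 1 := B')"
  have T'_simps: "T' a = A'" "T' (Suc a) = B'" "b \<noteq> a \<Longrightarrow> b \<noteq> a + 1 \<Longrightarrow> T' b = T b" for b
    by (auto simp: T'_def)
  have "columns n ?c' T'"
    unfolding columns_def
  proof (intro conjI ballI allI impI)
    fix b assume b: "b \<in> index_set n"
    have T_b: "T b \<subseteq> {1..?c (if b = 1 then 1 else b - 1)}" "card (T b) = ?c b"
      using cols b by (auto simp: columns_def)
    consider "b = a" | "b = Suc a" | "b \<noteq> a" "b \<noteq> a + 1" by fastforce
    then show "T' b \<subseteq> {1..?c' (if b = 1 then 1 else b - 1)}"
    proof cases
      case 1
      show ?thesis
      proof (cases "a = 1")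
        case True
        have "T' b = {1..?c a - 1}" unfolding 1 T'_simps(1) A'_def using True by simp
        also have "?c a - 1 = ?c' a" using c'_a by simp
        finally show ?thesis using 1 True by simp
      next
        case False
        then have "a - 1 \<noteq> a" using a by (auto simp: index_set_def)
        then show ?thesis
          using 1 False T_a(1) c'_other[of "a - 1"] by (auto simp: T'_simps A'_def)
      qed
    next
      case 2
      have "?c a - 1 = ?c' a" using c'_a by simp
      then show ?thesis using 2 B'(4) a by (auto simp: T'_simps index_set_def)
    next
      case 3
      then have "(if b = 1 then 1 else b - 1) \<noteq> a" by auto
      from c'_other[OF this] show ?thesis using T_b(1) T'_simps(3)[OF 3] by simp
    qed
    show "card (T' b) = ?c' b"
    proof (cases "b = a")
      case True
      then show ?thesis using card_A' c'_a by (simp add: T'_simps)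
    next
      case False
      then have "card (T' b) = card (T b)"
        using B'(3) T'_simps by (cases "b = a + 1") simp_all
      then show ?thesis using T_b(2) c'_other[OF False] by simp
    qed
  next
    fix b assume b: "b \<notin> index_set n"
    then have "T b = {}" "b \<noteq> a" using cols a by (auto simp: columns_def)
    moreover have "b = a + 1 \<Longrightarrow> B' = {}"
      using B'(3,4) \<open>T b = {}\<close> finite_subset by fastforce
    ultimately show "T' b = {}" using T'_simps by (cases "b = a + 1") auto
  qed
  moreover have "lower T' b i \<le> y" if iy: "(i, y) \<in># R' b" for b i y
  proof -
    have b: "b \<in> index_set n" using iy sup' by (force simp: supported_def)
    have lower_a: "lower T' a j \<le> num_le B' j - num_le (T a - {r}) j" for j
      using A'_ge[of j] by (simp add: lower_def T'_simps)
    from strings[OF iy] show ?thesis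
    proof (elim disjE exE conjE)
      assume "b = a" "k \<noteq> 1" "i = k - 1" "y = x + 1"
      then show ?thesis using B'(8)[of i] lower_a[of i] low_k k_pos by simp
    next
      fix z assume z: "(i, z) \<in># R b" "y = z - cartan b a * ?d i"
      have low_z: "lower T b i \<le> z" using low[OF z(1)] .
      from b a show ?thesis
      proof (cases rule: cartan_cases)
        case 1
        show ?thesis
        proof (cases "k \<le> i")
          case True
          then show ?thesis
            using B'(6)[of i] lower_a[of i] low_z z 1 by (simp add: lower_def)
        next
          case False
          then have "x < z" using min[of i z] z(1) 1 by simp
          then show ?thesis
            using B'(7)[of i] lower_a[of i] low_z low_k z(2) 1 False by (simp add: lower_def)
        qed
      next
        case 2
        have "card (T b) = ?c b" using cols b by (simp add: columns_def)
        then have "i \<le> card (T (a + 1))" using part_le_col_size[of i z R b n L] z(1) 2 by simp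
        from B'(5)[OF this] show ?thesis
          using low_z z 2 T'_simps(3)[of "b + 1"] by (auto simp: lower_def T'_simps)
      next
        case 3
        then have "a \<noteq> 1" using b by (auto simp: index_set_def)
        from A'_le[OF this, of i] show ?thesis
          using low_z z 3 T'_simps(1) T'_simps(3)[of b] by (auto simp: lower_def)
      next
        case 4
        then have "lower T' b i = lower T b i" using T'_simps(3)[of b] T'_simps(3)[of "b + 1"]
          by (simp add: lower_def)
        then show ?thesis using low_z z 4 by simp
      qed
    qed
  qed
  ultimately show "valid n L R' \<and> (\<exists>T'. bounded_below n L R' T')"
    using \<open>valid n L R'\<close> by (auto simp: bounded_below_def)
qed

section \<open>The operators act on the extended set and e is undone by f\<close>

definition extended :: "nat \<Rightarrow> (nat \<Rightarrow> nat \<Rightarrow> nat) \<Rightarrow> rigged \<Rightarrow> bool" where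
  "extended n L R \<longleftrightarrow> valid n L R \<and> (\<exists>T. bounded_below n L R T)"

lemma Min_label:
  fixes M :: "(nat \<times> int) multiset"
  assumes "M \<noteq> {#}" and x: "x = Min (snd ` set_mset M)"
  shows "finite {i. (i, x) \<in># M}" "{i. (i, x) \<in># M} \<noteq> {}" "(i, y) \<in># M \<Longrightarrow> x \<le> y"
proof -
  have "{i. (i, x) \<in># M} \<subseteq> fst ` set_mset M" by force
  then show "finite {i. (i, x) \<in># M}" by (rule finite_subset) simp
  have "x \<in> snd ` set_mset M" unfolding x using assms(1) by (intro Min_in) auto
  then show "{i. (i, x) \<in># M} \<noteq> {}" by force
  show "(i, y) \<in># M \<Longrightarrow> x \<le> y" unfolding x by (intro Min_le) force+
qed

lemma e_op_eq:
  assumes "e_op n L a R = Some R'"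
  obtains k x where "(k, x) \<in># R a" "x < 0"
    "\<And>i y. (i, y) \<in># R a \<Longrightarrow> x \<le> y \<and> (i < k \<longrightarrow> x < y)"
    "R' = modify n L R a {#(k, x)#} (if k = 1 then {#} else {#(k - 1, x + 1)#})"
proof -
  define x where "x = Min (snd ` set_mset (R a))"
  define k where "k = Min {i. (i, x) \<in># R a}"
  obtain i y where iy: "(i, y) \<in># R a" "y < 0"
    and R': "R' = modify n L R a {#(k, x)#} (if k = 1 then {#} else {#(k - 1, x + 1)#})"
    using assms unfolding e_op_def Let_def x_def[symmetric] k_def[symmetric]
    by (auto split: if_splits)
  then have ne: "R a \<noteq> {#}" by auto
  note M = Min_label[OF ne x_def]
  have "k \<in> {i. (i, x) \<in># R a}" unfolding k_def using M(1,2) by (rule Min_in)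
  moreover have "x < 0" using M(3)[OF iy(1)] iy(2) by simp
  moreover have "x \<le> y \<and> (i < k \<longrightarrow> x < y)" if "(i, y) \<in># R a" for i y
  proof -
    have "k \<le> i" if "y = x" unfolding k_def using M(1) \<open>(i, y) \<in># R a\<close> that by (intro Min_le) auto
    then show ?thesis using M(3)[OF that] by force
  qed
  ultimately show ?thesis using R' that by blast
qed

lemma f_op_eq:
  assumes "f_op n L a R = Some R'"
  obtains k x old where "(k, x) \<in># R a \<and> old = {#(k, x)#} \<or> k = 0 \<and> x = 0 \<and> old = {#}"
    "\<And>i y. (i, y) \<in># R a \<Longrightarrow> x \<le> y \<and> (k < i \<longrightarrow> x < y)"
    "R' = modify n L R a old {#(k + 1, x - 1)#}"
    "\<And>b i y. b \<in> index_set n \<Longrightarrow> (i, y) \<in># R' b \<Longrightarrow> y \<le> vacancy n L (shape R') b i"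
proof -
  define x where "x = Min (snd ` set_mset (R a))"
  define k where "k = Max {i. (i, x) \<in># R a}"
  have R': "R' = (if \<exists>(i, x)\<in>#R a. x \<le> 0 then modify n L R a {#(k, x)#} {#(k + 1, x - 1)#}
      else modify n L R a {#} {#(1, - 1)#})"
    and upper: "\<forall>b\<in>index_set n. \<forall>(i, x)\<in>#R' b. x \<le> vacancy n L (shape R') b i"
    using assms unfolding f_op_def Let_def x_def[symmetric] k_def[symmetric]
    by (simp_all only: option.simps simp_thms split: if_splits)
  have upper': "y \<le> vacancy n L (shape R') b i" if "b \<in> index_set n" "(i, y) \<in># R' b" for b i y
    using upper that by fastforce
  show ?thesis
  proof (cases "\<exists>(i, x)\<in>#R a. x \<le> 0")
    case True
    then have ne: "R a \<noteq> {#}" by auto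
    note M = Min_label[OF ne x_def]
    have "k \<in> {i. (i, x) \<in># R a}" unfolding k_def using M(1,2) by (rule Max_in)
    moreover have "x \<le> y \<and> (k < i \<longrightarrow> x < y)" if "(i, y) \<in># R a" for i y
    proof -
      have "i \<le> k" if "y = x" unfolding k_def using M(1) \<open>(i, y) \<in># R a\<close> that by (intro Max_ge) auto
      then show ?thesis using M(3)[OF that] by force
    qed
    moreover have "R' = modify n L R a {#(k, x)#} {#(k + 1, x - 1)#}" using R' True by simp
    ultimately show ?thesis using upper' that[of k x "{#(k, x)#}"] by simp
  next
    case False
    then have "R' = modify n L R a {#} {#(0 + 1, 0 - 1)#}" using R' by simp
    moreover have "0 \<le> y \<and> (0 < i \<longrightarrow> 0 < y)" if "(i, y) \<in># R a" for i y
      using False that by force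
    ultimately show ?thesis using upper' that[of 0 0 "{#}"] by blast
  qed
qed

lemma extended_e_op:
  assumes "multiplicity_array n L" "a \<in> index_set n" "extended n L R" "e_op n L a R = Some R'"
  shows "extended n L R'"
  using assms bounded_below_remove_box(1)[OF assms(1,2)] unfolding extended_def
  by (elim e_op_eq) blast

lemma extended_f_op:
  assumes "multiplicity_array n L" "a \<in> index_set n" "extended n L R" "f_op n L a R = Some R'"
  shows "extended n L R'"
proof -
  obtain T where T: "valid n L R" "bounded_below n L R T"
    using assms(3) unfolding extended_def by blast
  from assms(4) show ?thesis
  proof (rule f_op_eq)
    fix k x old
    assume "(k, x) \<in># R a \<and> old = {#(k, x)#} \<or> k = 0 \<and> x = 0 \<and> old = {#}"
      "\<And>i y. (i, y) \<in># R a \<Longrightarrow> x \<le> y \<and> (k < i \<longrightarrow> x < y)"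
      "R' = modify n L R a old {#(k + 1, x - 1)#}"
      "\<And>b i y. b \<in> index_set n \<Longrightarrow> (i, y) \<in># R' b \<Longrightarrow> y \<le> vacancy n L (shape R') b i"
    from bounded_below_add_box[OF assms(1,2) T this] show ?thesis by (simp add: extended_def)
  qed
qed

text \<open>
  After \<open>e\<^sub>a\<close> the shortened string has the smallest label and is the longest such string, because the
  strings at least as long as the selected one have gained two; so \<open>f\<^sub>a\<close> selects it again. If a
  string of length one was deleted, its label was \<open>- 1\<close>, so all remaining labels are positive and
  \<open>f\<^sub>a\<close> creates it anew.
\<close>

lemma f_op_e_op:
  assumes L: "multiplicity_array n L" and a: "a \<in> index_set n" and R: "extended n L R"
    and e: "e_op n L a R = Some R'"
  shows "f_op n L a R' = Some R"
    and "\<Sum>\<^sub># (shape R' a) < \<Sum>\<^sub># (shape R a)" and "b \<noteq> a \<Longrightarrow> shape R' b = shape R b"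
proof -
  obtain T where T: "valid n L R" "bounded_below n L R T"
    using R unfolding extended_def by blast
  then have sup: "supported n R" by (simp add: valid_def)
  obtain k x where kx: "(k, x) \<in># R a" "x < 0"
    and min: "\<And>i y. (i, y) \<in># R a \<Longrightarrow> x \<le> y \<and> (i < k \<longrightarrow> x < y)"
    and R': "R' = modify n L R a {#(k, x)#} (if k = 1 then {#} else {#(k - 1, x + 1)#})"
    using e by (rule e_op_eq) blast
  let ?new = "if k = 1 then {#} else {#(k - 1, x + 1)#}"
  have x1: "x = - 1" if "k = 1"
    using bounded_below_remove_box(2)[OF L a T kx min R'] that by blast
  have pos: "0 < i" if "(i, y) \<in># R a" for i y using T that by (auto simp: valid_def)
  have k_pos: "0 < k" using pos kx by blast
  have sub: "{#(k, x)#} \<subseteq># R a" using kx by simp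
  have sh: "shape R' = (shape R)(a := shape R a - {#k#} + image_mset fst ?new)"
    using shape_modify[of "{#(k, x)#}" R a n L ?new, OF sub] by (simp add: R')
  then show "b \<noteq> a \<Longrightarrow> shape R' b = shape R b" by simp
  obtain N where "shape R a = add_mset k N"
    using kx(1) multi_member_split[of k "shape R a"] in_shape_iff by blast
  then show "\<Sum>\<^sub># (shape R' a) < \<Sum>\<^sub># (shape R a)" using k_pos by (simp add: sh)
  let ?d = "\<lambda>i. if k \<le> i then - 1 else 0 :: int"
  have R'_eq: "R' = (\<lambda>b. image_mset (\<lambda>(i, y). (i, y - cartan b a * ?d i))
      (if b = a then R a - {#(k, x)#} else R b) + (if b = a then ?new else {#}))"
    unfolding R' using k_pos by (intro modify_eq(1)[OF L sup a sub]) auto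
  have strings: "(k \<noteq> 1 \<and> i = k - 1 \<and> y = x + 1) \<or>
      (\<exists>z. (i, z) \<in># R a \<and> y = z + (if k \<le> i then 2 else 0))" if "(i, y) \<in># R' a" for i y
    using that unfolding R'_eq by (auto simp: cartan_def split: if_splits dest: in_diffD)
  have undo: "modify n L R' a ?new {#(k, x)#} = R"
    unfolding R' by (rule modify_inverse[OF L sup a sub])
  have upper: "\<forall>b\<in>index_set n. \<forall>(i, x)\<in>#R b. x \<le> vacancy n L (shape R) b i"
    using T(1) by (auto simp: valid_def)
  show "f_op n L a R' = Some R"
  proof (cases "k = 1")
    case True
    have "0 < y" if "(i, y) \<in># R' a" for i y
      using strings[OF that] True x1 min pos by force
    then have "\<not> (\<exists>(i, x)\<in>#R' a. x \<le> 0)" by force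
    then show ?thesis using upper undo True x1 by (simp add: f_op_def)
  next
    case False
    then have new: "(k - 1, x + 1) \<in># R' a" by (simp add: R'_eq)
    have bounds: "x + 1 \<le> y \<and> (y = x + 1 \<longrightarrow> i \<le> k - 1)" if "(i, y) \<in># R' a" for i y
      using strings[OF that]
    proof (elim disjE exE conjE)
      fix z assume "(i, z) \<in># R a" "y = z + (if k \<le> i then 2 else 0)"
      then show ?thesis using min[of i z] by (cases "k \<le> i") auto
    qed simp
    have minx: "Min (snd ` set_mset (R' a)) = x + 1"
      using new bounds by (intro Min_eqI) force+
    have "finite {i. (i, x + 1) \<in># R' a}"
      by (rule finite_subset[of _ "{..k - 1}"]) (use bounds in auto)
    then have maxk: "Max {i. (i, x + 1) \<in># R' a} = k - 1"
      using new bounds by (intro Max_eqI) auto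
    have "\<exists>(i, x)\<in>#R' a. x \<le> 0" using new kx(2) by (intro bexI[of _ "(k - 1, x + 1)"]) auto
    then have "f_op n L a R' = (let R'' = modify n L R' a {#(k - 1, x + 1)#} {#(k - 1 + 1, x + 1 - 1)#}
        in if \<forall>b\<in>index_set n. \<forall>(i, x)\<in>#R'' b. x \<le> vacancy n L (shape R'') b i
           then Some R'' else None)"
      unfolding f_op_def by (simp only: if_True minx maxk Let_def)
    moreover have "modify n L R' a {#(k - 1, x + 1)#} {#(k - 1 + 1, x + 1 - 1)#} = R"
      using undo False k_pos by simp
    ultimately show ?thesis using upper by (simp add: Let_def)
  qed
qed

section \<open>Weights and highest weight elements\<close>

definition weight_of :: "nat \<Rightarrow> (nat \<Rightarrow> nat \<Rightarrow> nat) \<Rightarrow> config \<Rightarrow> weight" where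
  "weight_of n L \<nu> = (\<lambda>b. if b \<in> index_set n then vacancy_limit n L \<nu> b else 0)"

lemma cartan_commute: "cartan a b = cartan b a"
  by (auto simp: cartan_def)

lemma sum'_roots:
  "sum' (\<lambda>(a, i). int i * int (count (\<nu> a) i) * simple_root n a b) (node_set n)
     = (\<Sum>a\<in>index_set n. simple_root n a b * int (\<Sum>\<^sub># (\<nu> a)))"
  using sum'_node_set[of int "\<lambda>a. simple_root n a b" \<nu> n]
  by (simp add: case_prod_beta algebra_simps)

lemma sum'_lparts:
  fixes w :: "nat \<Rightarrow> 'b::comm_semiring_1"
  assumes L: "multiplicity_array n L"
  shows "sum' (\<lambda>(a, i). w a * of_nat i * of_nat (L a i)) (node_set n)
     = (\<Sum>a\<in>index_set n. w a * of_nat (\<Sum>\<^sub># (lparts n L a)))"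
proof -
  have "sum' (\<lambda>(a, i). w a * of_nat i * of_nat (L a i)) (node_set n)
      = sum' (\<lambda>(a, i). w a * of_nat i * of_nat (count (lparts n L a) i)) (node_set n)"
    by (intro sum.cong') (auto simp: count_lparts[OF L])
  also have "\<dots> = (\<Sum>a\<in>index_set n. w a * (\<Sum>i\<in>#lparts n L a. of_nat i))"
    by (rule sum'_node_set) simp
  finally show ?thesis by simp
qed

lemma weight_difference:
  assumes L: "multiplicity_array n L" and \<nu>: "supported n \<nu>"
  shows "(\<Sum>a\<in>index_set n. fund_weight a b * int (\<Sum>\<^sub># (lparts n L a)))
       - (\<Sum>a\<in>index_set n. simple_root n a b * int (\<Sum>\<^sub># (\<nu> a))) = weight_of n L \<nu> b"
proof (cases "b \<in> index_set n")
  case True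
  have "(\<Sum>a\<in>index_set n. simple_root n a b * int (\<Sum>\<^sub># (\<nu> a)))
      = (\<Sum>a\<in>index_set n. cartan b a * int (\<Sum>\<^sub># (\<nu> a)))"
    using True by (simp add: simple_root_def cartan_commute)
  also have "\<dots> = 2 * int (\<Sum>\<^sub># (\<nu> b)) - int (\<Sum>\<^sub># (\<nu> (b - 1))) - int (\<Sum>\<^sub># (\<nu> (b + 1)))"
    using \<nu> by (intro sum_cartan[OF True]) (simp add: supported_def)
  moreover have "(\<Sum>a\<in>index_set n. fund_weight a b * int (\<Sum>\<^sub># (lparts n L a)))
      = (\<Sum>a\<in>index_set n. if b = a then int (\<Sum>\<^sub># (lparts n L a)) else 0)"
    by (intro sum.cong) (auto simp: fund_weight_def)
  ultimately show ?thesis using True by (simp add: weight_of_def vacancy_limit_def)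
next
  case False
  then have "(\<Sum>a\<in>index_set n. fund_weight a b * int (\<Sum>\<^sub># (lparts n L a))) = 0"
    by (intro sum.neutral) (auto simp: fund_weight_def)
  then show ?thesis using False by (simp add: simple_root_def weight_of_def)
qed

lemma configs_iff:
  assumes L: "multiplicity_array n L"
  shows "\<nu> \<in> configs n L \<Lambda> \<longleftrightarrow>
    (\<forall>a. \<forall>i\<in>#\<nu> a. 0 < i) \<and> supported n \<nu> \<and> \<Lambda> = weight_of n L \<nu>"
proof -
  have fund: "sum' (\<lambda>(a, i). int i * int (L a i) * fund_weight a b) (node_set n)
      = (\<Sum>a\<in>index_set n. fund_weight a b * int (\<Sum>\<^sub># (lparts n L a)))" for b
    using sum'_lparts[OF L, of "\<lambda>a. fund_weight a b"] by (simp add: mult.commute mult.left_commute)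
  show ?thesis
    unfolding configs_def sum'_roots fund supported_def[symmetric] mem_Collect_eq
    using weight_difference[OF L, of \<nu>] by (auto simp: fun_eq_iff algebra_simps)
qed

lemma wt_eq:
  assumes L: "multiplicity_array n L" and R: "supported n R"
  shows "wt n L R = weight_of n L (shape R)"
proof
  fix b
  let ?f = "\<lambda>(a, i). fund_weight a b * int i * int (L a i)"
  let ?g = "\<lambda>(a, i). int i * int (count (shape R a) i) * simple_root n a b"
  have "{x \<in> node_set n. ?f x \<noteq> 0} \<subseteq> {(a, i) \<in> node_set n. L a i \<noteq> 0}" by auto
  then have finf: "finite {x \<in> node_set n. ?f x \<noteq> 0}"
    using L unfolding multiplicity_array_def by (rule finite_subset)
  have "{x \<in> node_set n. ?g x \<noteq> 0} \<subseteq> Sigma (index_set n) (\<lambda>a. set_mset (shape R a))"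
    by (auto simp: node_set_def not_in_iff)
  then have fing: "finite {x \<in> node_set n. ?g x \<noteq> 0}"
    by (rule finite_subset) auto
  have fing': "finite {x \<in> node_set n. - ?g x \<noteq> 0}" using fing by simp
  have "wt n L R b = sum' (\<lambda>x. ?f x + - ?g x) (node_set n)"
    unfolding wt_def by (intro sum.cong') (auto simp: algebra_simps)
  also have "\<dots> = sum' ?f (node_set n) + sum' (\<lambda>x. - ?g x) (node_set n)"
    using finf fing' by (rule sum.distrib')
  also have "sum' (\<lambda>x. - ?g x) (node_set n) = - sum' ?g (node_set n)"
    by (simp add: sum.G_def sum_negf)
  finally show "wt n L R b = weight_of n L (shape R) b"
    using weight_difference[OF L, of "shape R" b] R
    unfolding sum'_roots sum'_lparts[OF L, of "\<lambda>a. fund_weight a b"] by simp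
qed

text \<open>
  Once no label is negative, all vacancy numbers are nonnegative: at a part they bound a label, and
  elsewhere concavity applies. Their limits give dominance of the weight.
\<close>

lemma highest_weight_RC_bar:
  assumes L: "multiplicity_array n L" and R: "valid n L R"
    and nonneg: "\<And>a i x. a \<in> index_set n \<Longrightarrow> (i, x) \<in># R a \<Longrightarrow> 0 \<le> x"
  shows "R \<in> RC_bar n L"
proof -
  let ?\<Lambda> = "weight_of n L (shape R)"
  have sup: "supported n (shape R)" using R by (simp add: valid_def)
  have str: "0 < i" "x \<le> vacancy n L (shape R) a i" if "(i, x) \<in># R a" for a i x
    using R that by (auto simp: valid_def)
  have parts: "0 \<le> vacancy n L (shape R) a i" if "a \<in> index_set n" "i \<in># shape R a" for a i
    using that nonneg[of a i] str(2)[of i _ a] unfolding in_shape_iff by force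
  have zero: "0 \<le> vacancy n L (shape R) a 0" if "a \<in> index_set n" for a
    using vacancy_0[OF L sup that] by simp
  have "0 \<le> vacancy_limit n L (shape R) a" if "a \<in> index_set n" for a
    by (rule vacancy_limit_ge[OF L sup that zero[OF that]]) (rule parts[OF that])
  then have dom: "dominant n ?\<Lambda>" by (auto simp: dominant_def weight_of_def)
  have "0 \<le> vacancy n L (shape R) a i" if "a \<in> index_set n" for a i
    by (rule vacancy_ge_between_parts[OF L sup that zero[OF that]]) (use parts[OF that] in auto)
  then have adm: "admissible n L (shape R)" by (auto simp: admissible_def node_set_def)
  have "shape R \<in> configs n L ?\<Lambda>"
    unfolding configs_iff[OF L] using sup str(1) by (auto simp: in_shape_iff)
  then have "R \<in> RC_bar_at n L ?\<Lambda>"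
    using adm nonneg str(2) by (fastforce simp: RC_bar_at_def)
  then show ?thesis using dom by (auto simp: RC_bar_def)
qed

text \<open>
  For a dominant weight the second differences of the column lengths are nonnegative, and the
  last length is 0, so the lengths decrease. Hence column \<open>k\<close> may consist of its \<open>c\<^sub>k\<close> smallest
  letters, which makes every lower bound nonpositive.
\<close>

lemma RC_bar_extended:
  assumes L: "multiplicity_array n L" and R: "R \<in> RC_bar n L"
  shows "extended n L R"
proof -
  let ?c = "col_size n L (shape R)"
  obtain \<Lambda> where \<Lambda>: "dominant n \<Lambda>" "shape R \<in> configs n L \<Lambda>"
    and labels: "\<forall>a\<in>index_set n. \<forall>(i, x)\<in>#R a. 0 \<le> x \<and> x \<le> vacancy n L (shape R) a i"
    using R by (auto simp: RC_bar_def RC_bar_at_def)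
  then have pos: "\<forall>a. \<forall>i\<in>#shape R a. 0 < i" and sup: "supported n R"
    and w: "\<Lambda> = weight_of n L (shape R)"
    by (auto simp: configs_iff[OF L])
  have in_index: "a \<in> index_set n" if "(i, x) \<in># R a" for a i x
    using sup that by (force simp: supported_def)
  have label: "0 \<le> x" "x \<le> vacancy n L (shape R) a i" if "(i, x) \<in># R a" for a i x
    using labels in_index[OF that] that by fastforce+
  have "valid n L R"
    using sup label(2) pos by (auto simp: valid_def in_shape_iff)
  moreover have c_0: "?c k = 0" if "n \<le> k" for k
    using sup that by (auto simp: col_size_def supported_def shape_def index_set_def)
  have antimono: "?c b \<le> ?c (b - 1)" if "1 \<le> b" "b \<le> n" for b
    using that(2,1)
  proof (induction b rule: inc_induct)
    case base
    then show ?case using c_0 by simp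
  next
    case (step b)
    then have b: "b \<in> index_set n" by (simp add: index_set_def)
    then have "0 \<le> vacancy_limit n L (shape R) b"
      using \<Lambda>(1) unfolding w dominant_def weight_of_def by auto
    then have "2 * ?c b \<le> ?c (b - 1) + ?c (b + 1)"
      using col_size_second_difference[OF b, of L "shape R"] by linarith
    then show ?case using step.IH by simp
  qed
  define T where "T k = (if k \<in> index_set n then {1..?c k} else {})" for k
  have T: "T k = {1..?c k}" if "1 \<le> k" for k
    using c_0[of k] that by (auto simp: T_def index_set_def)
  have "columns n ?c T"
    unfolding columns_def
  proof (intro conjI ballI allI impI)
    fix k assume k: "k \<in> index_set n"
    then show "T k \<subseteq> {1..?c (if k = 1 then 1 else k - 1)}"
      using antimono[of k] by (auto simp: T_def index_set_def)
    show "card (T k) = ?c k" using k by (simp add: T_def)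
  qed (simp add: T_def)
  moreover have "lower T a i \<le> x" if "(i, x) \<in># R a" for a i x
  proof -
    have a: "1 \<le> a" "a < n" using in_index[OF that] by (auto simp: index_set_def)
    then have "?c (a + 1) \<le> ?c a" using antimono[of "a + 1"] by simp
    then have "lower T a i \<le> 0" using T[of a] T[of "a + 1"] a by (simp only: lower_def num_le_interval)
    then show ?thesis using label(1)[OF that] by simp
  qed
  ultimately show ?thesis by (auto simp: extended_def bounded_below_def)
qed

text \<open>
  Each \<open>e\<^sub>a\<close> removes a box, so the process of applying them ends, and it ends at a configuration
  without negative labels; the operators \<open>f\<^sub>a\<close> lead back.
\<close>

lemma extended_in_RC:
  assumes L: "multiplicity_array n L" and "extended n L R"
  shows "R \<in> RC n L"
  using assms(2)
proof (induction "\<Sum>a\<in>index_set n. \<Sum>\<^sub># (shape R a)" arbitrary: R rule: less_induct)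
  case less
  show ?case
  proof (cases "\<exists>a\<in>index_set n. \<exists>(i, x)\<in>#R a. x < 0")
    case True
    then obtain a where a: "a \<in> index_set n" and "\<exists>(i, x)\<in>#R a. x < 0" by blast
    then obtain R' where e: "e_op n L a R = Some R'" by (simp add: e_op_def Let_def)
    note ext = \<open>extended n L R\<close>
    have "(\<Sum>b\<in>index_set n. \<Sum>\<^sub># (shape R' b)) < (\<Sum>b\<in>index_set n. \<Sum>\<^sub># (shape R b))"
    proof (rule sum_strict_mono_ex1)
      show "\<forall>b\<in>index_set n. \<Sum>\<^sub># (shape R' b) \<le> \<Sum>\<^sub># (shape R b)"
        using f_op_e_op(2,3)[OF L a ext e] by (metis le_refl less_imp_le)
      show "\<exists>b\<in>index_set n. \<Sum>\<^sub># (shape R' b) < \<Sum>\<^sub># (shape R b)"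
        using f_op_e_op(2)[OF L a ext e] a by blast
    qed simp
    then have "R' \<in> RC n L" using extended_e_op[OF L a ext e] by (rule less.hyps)
    then show ?thesis using a f_op_e_op(1)[OF L a ext e] by (rule RC.f_step)
  next
    case False
    then have "R \<in> RC_bar n L"
      using less.prems by (intro highest_weight_RC_bar[OF L]) (force simp: extended_def)+
    then show ?thesis by (rule RC.base)
  qed
qed

lemma RC_iff_extended:
  assumes L: "multiplicity_array n L"
  shows "R \<in> RC n L \<longleftrightarrow> extended n L R"
proof
  show "R \<in> RC n L \<Longrightarrow> extended n L R"
    by (induction rule: RC.induct)
      (use RC_bar_extended[OF L] extended_e_op[OF L] extended_f_op[OF L] in blast)+
qed (rule extended_in_RC[OF L])

section \<open>Tableaux, quasipartitions and weights\<close>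

lemma quasipartition_labels:
  "quasipartition M p (count (shape R a) i) (labels R a i)
     \<longleftrightarrow> (\<forall>x. (i, x) \<in># R a \<longrightarrow> M \<le> x \<and> x \<le> p)"
proof -
  let ?F = "image_mset snd (filter_mset (\<lambda>s. fst s = i) (R a))"
  let ?xs = "labels R a i"
  have "mset ?xs = ?F" by (simp add: labels_def)
  then have set: "set ?xs = {x. (i, x) \<in># R a}" and "length ?xs = size ?F"
    by (force simp flip: set_mset_mset, metis size_mset)
  moreover have "count (image_mset fst M) i = size (filter_mset (\<lambda>s. fst s = i) M)"
    for M :: "(nat \<times> int) multiset"
    by (induction M) auto
  ultimately have len: "length ?xs = count (shape R a) i"
    by (simp add: shape_def)
  have sorted: "sorted_wrt (\<ge>) ?xs"
    by (simp add: labels_def sorted_wrt_rev)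
  show ?thesis
  proof (cases "?xs = []")
    case True
    then show ?thesis using set len by (auto simp: quasipartition_def)
  next
    case False
    have "x \<le> hd ?xs" "last ?xs \<le> x" if x: "x \<in> set ?xs" for x
    proof -
      obtain k where k: "k < length ?xs" "x = ?xs ! k" using x by (auto simp: in_set_conv_nth)
      have mono: "?xs ! j \<le> ?xs ! i" if "i \<le> j" "j < length ?xs" for i j
        using sorted_wrt_nth_less[OF sorted, of i j] that by (cases "i = j") auto
      show "x \<le> hd ?xs" "last ?xs \<le> x"
        using mono[of 0 k] mono[of k "length ?xs - 1"] k False
        by (auto simp: hd_conv_nth last_conv_nth)
    qed
    then have "(\<forall>x\<in>set ?xs. M \<le> x \<and> x \<le> p) \<longleftrightarrow> M \<le> last ?xs \<and> hd ?xs \<le> p"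
      using False by (meson hd_in_set last_in_set order_trans)
    moreover have "0 < count (shape R a) i" using False len by (metis length_greater_0_conv)
    then have "quasipartition M p (count (shape R a) i) ?xs \<longleftrightarrow> M \<le> last ?xs \<and> hd ?xs \<le> p"
      using len sorted unfolding quasipartition_def by blast
    ultimately show ?thesis by (simp add: set)
  qed
qed

lemma sum_column:
  fixes t :: "nat \<Rightarrow> nat"
  assumes "inj_on t {1..c}"
  shows "(\<Sum>j=1..c. if t j \<le> i then 1 else 0) = num_le (t ` {1..c}) i"
proof -
  have "t ` {1..c} \<inter> {..i} = t ` {j\<in>{1..c}. t j \<le> i}" by auto
  moreover have "inj_on t {j\<in>{1..c}. t j \<le> i}" using assms by (rule inj_on_subset) auto
  ultimately have "num_le (t ` {1..c}) i = int (card {j\<in>{1..c}. t j \<le> i})"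
    by (simp add: num_le_def card_image)
  also have "\<dots> = (\<Sum>j=1..c. if t j \<le> i then 1 else 0)"
    by (simp add: sum.If_cases Int_def)
  finally show ?thesis by simp
qed

lemma decreasing_inj_on:
  fixes t :: "nat \<Rightarrow> nat"
  assumes "\<And>j. 1 \<le> j \<Longrightarrow> j < c \<Longrightarrow> t (j + 1) < t j"
  shows "inj_on t {1..c}"
proof -
  have less: "t k < t j" if "1 \<le> j" "j < k" "k \<le> c" for j k
    using that(2,3)
  proof (induction k)
    case (Suc k)
    then show ?case using assms[of k] \<open>1 \<le> j\<close> by (cases "j = k") auto
  qed simp
  show ?thesis
    by (rule linorder_inj_onI) (use less in force)+
qed

lemma col_len_n: "col_len n lam n = 0" if "1 \<le> n"
  using that by (simp add: col_len_def)

lemma col_len_pred: "k \<in> index_set n \<Longrightarrow> col_len n lam (k - 1) = col_len n lam (if k = 1 then 1 else k - 1)"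
  by (auto simp: col_len_def index_set_def numeral_2_eq_2)

lemma lower_bound_columns:
  assumes "t \<in> tableaux n lam" "a \<in> index_set n"
    and T: "\<And>k. T k = (if k \<in> index_set n then (\<lambda>j. t j k) ` {1..col_len n lam k} else {})"
  shows "lower_bound n lam t a i = lower T a i"
proof -
  have "(\<Sum>j=1..col_len n lam k. if t j k \<le> i then 1 else 0) = num_le (T k) i" if "1 \<le> k" "k \<le> n" for k
  proof (cases "k \<in> index_set n")
    case True
    then have "inj_on (\<lambda>j. t j k) {1..col_len n lam k}"
      using assms(1) by (intro decreasing_inj_on) (auto simp: tableaux_def)
    from sum_column[OF this] show ?thesis using True by (simp only: T if_True)
  next
    case False
    then have "k = n" "1 \<le> n" using that by (auto simp: index_set_def)
    then show ?thesis using False by (simp add: T col_len_n num_le_def)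
  qed
  from this[of a] this[of "a + 1"] show ?thesis
    using assms(2) by (simp add: lower_bound_def lower_def index_set_def)
qed

lemma tableau_columns:
  assumes t: "t \<in> tableaux n lam"
  shows "\<exists>T. columns n (col_len n lam) T \<and> (\<forall>a\<in>index_set n. \<forall>i. lower_bound n lam t a i = lower T a i)"
proof -
  define T where "T k = (if k \<in> index_set n then (\<lambda>j. t j k) ` {1..col_len n lam k} else {})" for k
  have "columns n (col_len n lam) T"
    unfolding columns_def
  proof (intro conjI ballI allI impI)
    fix k assume k: "k \<in> index_set n"
    have "inj_on (\<lambda>j. t j k) {1..col_len n lam k}"
      using t k by (intro decreasing_inj_on) (auto simp: tableaux_def)
    then show "card (T k) = col_len n lam k"
      using k by (simp add: T_def card_image)
    have "\<forall>j\<in>{1..col_len n lam k}. t j k \<in> {1..col_len n lam (k - 1)}"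
      using t k by (auto simp: tableaux_def)
    then show "T k \<subseteq> {1..col_len n lam (if k = 1 then 1 else k - 1)}"
      using k unfolding col_len_pred[OF k] by (auto simp: T_def)
  qed (simp add: T_def)
  then show ?thesis using lower_bound_columns[OF t] T_def by blast
qed

lemma columns_tableau:
  assumes T: "columns n (col_len n lam) T"
  shows "\<exists>t\<in>tableaux n lam. \<forall>a\<in>index_set n. \<forall>i. lower_bound n lam t a i = lower T a i"
proof -
  let ?c = "col_len n lam"
  let ?xs = "\<lambda>k. rev (sorted_list_of_set (T k))"
  define t where "t j k = (if k \<in> index_set n \<and> j \<in> {1..?c k} then ?xs k ! (j - 1) else 0)" for j k
  have T_k: "T k \<subseteq> {1..?c (k - 1)}" "card (T k) = ?c k" "finite (T k)" if "k \<in> index_set n" for k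
  proof -
    have "T k \<subseteq> {1..?c (if k = 1 then 1 else k - 1)}" "card (T k) = ?c k"
      using T that by (auto simp: columns_def)
    then show "T k \<subseteq> {1..?c (k - 1)}" "card (T k) = ?c k"
      unfolding col_len_pred[OF that] by auto
    then show "finite (T k)" using finite_subset by blast
  qed
  have len: "length (?xs k) = ?c k" "set (?xs k) = T k" if "k \<in> index_set n" for k
    using T_k[OF that] by auto
  have image: "(\<lambda>j. t j k) ` {1..?c k} = T k" if k: "k \<in> index_set n" for k
  proof -
    have "(\<lambda>j. t j k) ` {1..?c k} = (\<lambda>j. ?xs k ! j) ` ((\<lambda>j. j - 1) ` {1..?c k})"
      unfolding image_image using k by (intro image_cong) (auto simp: t_def)
    also have "(\<lambda>j. j - 1) ` {1..?c k} = {..<length (?xs k)}"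
    proof -
      have "(\<lambda>j. j - 1) ` (Suc ` {..<?c k}) = {..<?c k}" by (simp add: image_image)
      moreover have "Suc ` {..<?c k} = {1..?c k}"
        by (simp add: lessThan_atLeast0 atLeastLessThanSuc_atLeastAtMost)
      ultimately show ?thesis using len(1)[OF k] by simp
    qed
    also have "(\<lambda>j. ?xs k ! j) ` {..<length (?xs k)} = set (?xs k)"
      by (auto simp: set_conv_nth)
    finally show ?thesis using len(2)[OF k] by simp
  qed
  have "t \<in> tableaux n lam"
    unfolding tableaux_def mem_Collect_eq
  proof (intro conjI ballI allI impI)
    fix k j assume "k \<in> index_set n" "j \<in> {1..?c k}"
    then show "t j k \<in> {1..?c (k - 1)}" using image T_k(1) by blast
  next
    fix k j assume k: "k \<in> index_set n" and j: "1 \<le> j \<and> j < ?c k"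
    have "sorted_wrt (>) (?xs k)"
      by (simp add: sorted_wrt_rev)
    then have "?xs k ! j < ?xs k ! (j - 1)"
      using j len(1)[OF k] sorted_wrt_nth_less[of "(>)" "?xs k" "j - 1" j] by simp
    then show "t (j + 1) k < t j k" using k j by (auto simp: t_def)
  next
    fix j k assume "\<not> (k \<in> index_set n \<and> j \<in> {1..?c k})"
    then show "t j k = 0" unfolding t_def by (rule if_not_P)
  qed
  moreover have "T k = (if k \<in> index_set n then (\<lambda>j. t j k) ` {1..?c k} else {})" for k
    using image[of k] T by (simp add: columns_def)
  ultimately show ?thesis using lower_bound_columns by blast
qed

lemma tuple_weight_eq:
  "tuple_weight n lam b = (if b \<in> index_set n then int (lam b) - int (lam (b + 1)) else 0)"
proof -
  have "tuple_weight n lam b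
      = (\<Sum>i\<in>index_set n. if b = i then int (lam i) - int (lam (i + 1)) else 0)"
    unfolding tuple_weight_def by (intro sum.cong) (auto simp: fund_weight_def)
  then show ?thesis by simp
qed

lemma second_difference_zero:
  fixes d :: "nat \<Rightarrow> int"
  assumes step: "\<And>b. 1 \<le> b \<Longrightarrow> b < n \<Longrightarrow> d (b - 1) - 2 * d b + d (b + 1) = 0"
    and "d 0 = 0" "d n = 0" "k \<le> n"
  shows "d k = 0"
proof -
  have linear: "d k = int k * d 1" if "k \<le> n" for k
    using that
  proof (induction k rule: less_induct)
    case (less k)
    show ?case
    proof (cases "k \<le> 1")
      case True
      then have "k = 0 \<or> k = 1" by auto
      then show ?thesis using \<open>d 0 = 0\<close> by auto
    next
      case False
      define b where "b = k - 1"
      with False have b: "k = b + 1" "1 \<le> b" by auto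
      have "d (b - 1) = int (b - 1) * d 1" "d b = int b * d 1"
        using less.prems b by (intro less.IH; simp)+
      moreover have "d (b - 1) - 2 * d b + d (b + 1) = 0"
        using less.prems b by (intro step) simp_all
      ultimately have "d (b + 1) = (2 * int b - int (b - 1)) * d 1"
        by (simp add: left_diff_distrib)
      also have "2 * int b - int (b - 1) = int (b + 1)" using b(2) by simp
      finally show ?thesis unfolding b(1) .
    qed
  qed
  show ?thesis
  proof (cases "k = 0")
    case False
    then have "d 1 = 0" using linear[of n] \<open>d n = 0\<close> \<open>k \<le> n\<close> by auto
    then show ?thesis using linear[OF \<open>k \<le> n\<close>] by simp
  qed (simp add: \<open>d 0 = 0\<close>)
qed

text \<open>
  The weight determines the second differences of the column lengths, and the sum of \<open>lam\<close>
  fixes the value at 0.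
\<close>

lemma col_size_eq_col_len:
  assumes L: "multiplicity_array n L" and R: "supported n R"
    and total: "(\<Sum>i=1..n. lam i) = sum' (\<lambda>(a, i). a * i * L a i) (node_set n)"
    and w: "weight_of n L (shape R) = tuple_weight n lam"
    and k: "k \<in> index_set n"
  shows "col_size n L (shape R) k = col_len n lam k"
proof -
  define d where "d k = int (col_size n L (shape R) k) - int (\<Sum>j=k+1..n. lam j)" for k
  have "sum' (\<lambda>(a, i). a * i * L a i) (node_set n) = (\<Sum>a\<in>index_set n. a * \<Sum>\<^sub># (lparts n L a))"
    using sum'_lparts[OF L, of "\<lambda>a. a"] by simp
  then have "d 0 = 0"
    using total R by (simp add: d_def col_size_def supported_def shape_def index_set_def)
  moreover have "d n = 0"
    using R by (auto simp: d_def col_size_def supported_def shape_def index_set_def)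
  moreover have "d (b - 1) - 2 * d b + d (b + 1) = 0" if "1 \<le> b" "b < n" for b
  proof -
    have b: "b \<in> index_set n" using that by (simp add: index_set_def)
    have "(\<Sum>j=b..n. lam j) = lam b + (\<Sum>j=b+1..n. lam j)"
      "(\<Sum>j=b+1..n. lam j) = lam (b + 1) + (\<Sum>j=b+1+1..n. lam j)"
      using that sum.atLeast_Suc_atMost[of b n lam] sum.atLeast_Suc_atMost[of "b + 1" n lam] by simp_all
    moreover have "vacancy_limit n L (shape R) b = int (lam b) - int (lam (b + 1))"
      using fun_cong[OF w, of b] b by (simp add: weight_of_def tuple_weight_eq)
    ultimately show ?thesis
      using col_size_second_difference[OF b, of L "shape R"] that(1) by (simp add: d_def)
  qed
  ultimately have "d k = 0"
    using second_difference_zero[of n d k] k by (simp add: index_set_def)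
  then have "col_size n L (shape R) k = (\<Sum>j=k+1..n. lam j)"
    unfolding d_def by (simp only: right_minus_eq of_nat_eq_iff)
  then show ?thesis using k by (simp add: col_len_def index_set_def)
qed

lemma columns_cong:
  assumes "\<And>k. k \<in> index_set n \<Longrightarrow> c k = c' k"
  shows "columns n c T \<longleftrightarrow> columns n c' T"
proof -
  have "c (if k = 1 then 1 else k - 1) = c' (if k = 1 then 1 else k - 1)" if "k \<in> index_set n" for k
    using that by (intro assms) (auto simp: index_set_def)
  then show ?thesis using assms by (auto simp: columns_def)
qed

theorem theorem4p6:
  fixes n :: nat and L :: "nat \<Rightarrow> nat \<Rightarrow> nat" and lam :: "nat \<Rightarrow> nat"
  assumes "2 \<le> n"
    and "multiplicity_array n L"
    and "(\<Sum>i=1..n. lam i) = sum' (\<lambda>(a, i). a * i * L a i) (node_set n)"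
  shows "unrestricted_RC n L lam = extended_RC n L lam"
proof (rule set_eqI)
  fix R
  note L = \<open>multiplicity_array n L\<close>
  let ?w = "weight_of n L (shape R) = tuple_weight n lam"
  let ?upper = "\<forall>a i x. (i, x) \<in># R a \<longrightarrow> 0 < i \<and> x \<le> vacancy n L (shape R) a i"
  let ?low = "\<lambda>M. \<forall>a i x. (i, x) \<in># R a \<longrightarrow> M a i \<le> x"
  have "extended n L R \<Longrightarrow> wt n L R = weight_of n L (shape R)"
    unfolding extended_def valid_def using wt_eq[OF L] by blast
  then have "R \<in> unrestricted_RC n L lam \<longleftrightarrow> extended n L R \<and> ?w"
    unfolding unrestricted_RC_def mem_Collect_eq RC_iff_extended[OF L]
    by (cases "extended n L R") simp_all
  also have "\<dots> \<longleftrightarrow> supported n R \<and> ?w \<and> ?upper \<and> (\<exists>T. columns n (col_len n lam) T \<and> ?low (lower T))"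
    using columns_cong[of n "col_size n L (shape R)" "col_len n lam"]
      col_size_eq_col_len[OF L _ assms(3), of R]
    unfolding extended_def valid_def bounded_below_def by blast
  also have "\<dots> \<longleftrightarrow> supported n R \<and> ?w \<and> ?upper \<and> (\<exists>t\<in>tableaux n lam. ?low (lower_bound n lam t))"
  proof (intro conj_cong refl)
    assume sup: "supported n R"
    have "a \<in> index_set n" if "(i, x) \<in># R a" for a i x
      using sup that by (force simp: supported_def)
    then have transfer: "?low M" if "?low M'" "\<forall>a\<in>index_set n. \<forall>i. M a i = M' a i" for M M'
      using that by metis
    show "(\<exists>T. columns n (col_len n lam) T \<and> ?low (lower T))
        \<longleftrightarrow> (\<exists>t\<in>tableaux n lam. ?low (lower_bound n lam t))"
    proof
      assume "\<exists>T. columns n (col_len n lam) T \<and> ?low (lower T)"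
      then obtain T where T: "columns n (col_len n lam) T" "?low (lower T)" by blast
      from columns_tableau[OF T(1)] obtain t where t: "t \<in> tableaux n lam"
        "\<forall>a\<in>index_set n. \<forall>i. lower_bound n lam t a i = lower T a i" by blast
      show "\<exists>t\<in>tableaux n lam. ?low (lower_bound n lam t)"
        using t(1) transfer[OF T(2) t(2)] by blast
    next
      assume "\<exists>t\<in>tableaux n lam. ?low (lower_bound n lam t)"
      then obtain t where t: "t \<in> tableaux n lam" "?low (lower_bound n lam t)" by blast
      from tableau_columns[OF t(1)] obtain T where T: "columns n (col_len n lam) T"
        "\<forall>a\<in>index_set n. \<forall>i. lower T a i = lower_bound n lam t a i" by metis
      show "\<exists>T. columns n (col_len n lam) T \<and> ?low (lower T)"
        using T(1) transfer[OF t(2) T(2)] by blast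
    qed
  qed
  also have "\<dots> \<longleftrightarrow> R \<in> extended_RC n L lam"
  proof -
    have conf: "shape R \<in> configs n L (tuple_weight n lam)
        \<longleftrightarrow> supported n R \<and> ?w \<and> (\<forall>a i x. (i, x) \<in># R a \<longrightarrow> 0 < i)"
    proof -
      have "(\<forall>a. \<forall>i\<in>#shape R a. 0 < i) \<longleftrightarrow> (\<forall>a i x. (i, x) \<in># R a \<longrightarrow> 0 < i)"
        using in_shape_iff[of _ R] by blast
      then show ?thesis unfolding configs_iff[OF L] by auto
    qed
    have "(\<forall>(a, i)\<in>node_set n. \<forall>x. (i, x) \<in># R a \<longrightarrow> M a i \<le> x \<and> x \<le> vacancy n L (shape R) a i)
        \<longleftrightarrow> (\<forall>a i x. (i, x) \<in># R a \<longrightarrow> M a i \<le> x \<and> x \<le> vacancy n L (shape R) a i)"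
      if "supported n R" "\<forall>a i x. (i, x) \<in># R a \<longrightarrow> 0 < i" for M
    proof -
      have "(a, i) \<in> node_set n" if "(i, x) \<in># R a" for a i x
        using \<open>supported n R\<close> \<open>\<forall>a i x. (i, x) \<in># R a \<longrightarrow> 0 < i\<close> that
        by (force simp: supported_def node_set_def)
      then show ?thesis by blast
    qed
    then show ?thesis
      unfolding extended_RC_def mem_Collect_eq conf quasipartition_labels by blast
  qed
  finally show "R \<in> unrestricted_RC n L lam \<longleftrightarrow> R \<in> extended_RC n L lam" .
qed

end
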